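(* Let $G$ be a unimodular locally compact group. Then the reduced group $C^*$-algebra $C^*_r(G)$ is quasi-directly finite.
   Context: $C^*_r(G)$ is the norm closure of the image of $L^1(G)$ under the left regular representation on $L^2(G)$. For $a,b$ in a ring $R$ (not necessarily unital), $a\diamond b := a+b-ab$; if $a\diamond b=0$ then $a$ is a left quasi-inverse of $b$ and $b$ a right quasi-inverse of $a$. A ring $R$ is quasi-directly finite if every element having a left quasi-inverse in $R$ also has a right quasi-inverse in $R$ (equivalently, for a non-unital algebra, its forced unitization is directly finite: every left-invertible element is right-invertible). *)

theory Defs
  imports "HOL-Analysis.Analysis"
begin

text \<open>A locally compact group is modelled as a type of class
  topological_group_add (a not necessarily commutative group, written
  additively, with continuous group operations) which is Hausdorff (t2_space)
  and locally compact.  The group product g h is written g + h and the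
  inverse of g is written - g.\<close>

definition locally_compact_group :: "'g::{topological_group_add,t2_space} itself \<Rightarrow> bool" where
  "locally_compact_group _ \<longleftrightarrow> locally_compact_space (euclidean :: 'g topology)"

definition left_haar_measure :: "'g::{topological_group_add,t2_space} measure \<Rightarrow> bool" where
  "left_haar_measure \<mu> \<longleftrightarrow>
     sets \<mu> = sets borel \<and> space \<mu> = UNIV \<and>
     (\<forall>g. \<forall>A\<in>sets borel. emeasure \<mu> ((\<lambda>x. g + x) ` A) = emeasure \<mu> A) \<and>
     (\<forall>K. compact K \<longrightarrow> emeasure \<mu> K < \<infinity>) \<and>
     (\<forall>A\<in>sets borel. emeasure \<mu> A = (INF U\<in>{U. open U \<and> A \<subseteq> U}. emeasure \<mu> U)) \<and>
     (\<forall>U. open U \<longrightarrow> emeasure \<mu> U = (SUP K\<in>{K. compact K \<and> K \<subseteq> U}. emeasure \<mu> K)) \<and>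
     emeasure \<mu> UNIV \<noteq> 0"

definition right_invariant :: "'g::group_add measure \<Rightarrow> bool" where
  "right_invariant \<mu> \<longleftrightarrow> (\<forall>g. \<forall>A\<in>sets \<mu>. emeasure \<mu> ((\<lambda>x. x + g) ` A) = emeasure \<mu> A)"

definition L2 :: "'g measure \<Rightarrow> ('g \<Rightarrow> complex) \<Rightarrow> bool" where
  "L2 \<mu> \<xi> \<longleftrightarrow> \<xi> \<in> borel_measurable \<mu> \<and> integrable \<mu> (\<lambda>x. (cmod (\<xi> x))\<^sup>2)"

definition L2_norm :: "'g measure \<Rightarrow> ('g \<Rightarrow> complex) \<Rightarrow> real" where
  "L2_norm \<mu> \<xi> = sqrt (\<integral>x. (cmod (\<xi> x))\<^sup>2 \<partial>\<mu>)"

definition left_reg :: "'g::group_add measure \<Rightarrow> ('g \<Rightarrow> complex) \<Rightarrow> ('g \<Rightarrow> complex) \<Rightarrow> ('g \<Rightarrow> complex)" where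
  "left_reg \<mu> f \<xi> = (\<lambda>x. \<integral>y. f y * \<xi> (- y + x) \<partial>\<mu>)"

text \<open>The reduced group C*-algebra: operators on L^2(G) (acting on representatives)
  lying in the operator-norm closure of lambda(L^1(G)).\<close>

definition reduced_group_Cstar ::
  "'g::group_add measure \<Rightarrow> (('g \<Rightarrow> complex) \<Rightarrow> ('g \<Rightarrow> complex)) set" where
  "reduced_group_Cstar \<mu> = {T.
     (\<forall>\<xi>. L2 \<mu> \<xi> \<longrightarrow> L2 \<mu> (T \<xi>)) \<and>
     (\<forall>\<epsilon>>0. \<exists>f. integrable \<mu> f \<and>
        (\<forall>\<xi>. L2 \<mu> \<xi> \<longrightarrow> L2 \<mu> (left_reg \<mu> f \<xi>) \<and>
              L2_norm \<mu> (\<lambda>x. T \<xi> x - left_reg \<mu> f \<xi> x) \<le> \<epsilon> * L2_norm \<mu> \<xi>))}"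

definition op_eq :: "'g measure \<Rightarrow> (('g \<Rightarrow> complex) \<Rightarrow> ('g \<Rightarrow> complex)) \<Rightarrow> (('g \<Rightarrow> complex) \<Rightarrow> ('g \<Rightarrow> complex)) \<Rightarrow> bool" where
  "op_eq \<mu> S T \<longleftrightarrow> (\<forall>\<xi>. L2 \<mu> \<xi> \<longrightarrow> (AE x in \<mu>. S \<xi> x = T \<xi> x))"

definition op_diamond :: "(('g \<Rightarrow> complex) \<Rightarrow> ('g \<Rightarrow> complex)) \<Rightarrow> (('g \<Rightarrow> complex) \<Rightarrow> ('g \<Rightarrow> complex)) \<Rightarrow> (('g \<Rightarrow> complex) \<Rightarrow> ('g \<Rightarrow> complex))" where
  "op_diamond a b = (\<lambda>\<xi> x. a \<xi> x + b \<xi> x - a (b \<xi>) x)"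

text \<open>Quasi-direct finiteness of a ring R (given by its carrier, the circle operation,
  the equality relation and zero): every element with a left quasi-inverse in R
  has a right quasi-inverse in R.\<close>

definition quasi_directly_finite :: "'a set \<Rightarrow> ('a \<Rightarrow> 'a \<Rightarrow> 'a) \<Rightarrow> ('a \<Rightarrow> 'a \<Rightarrow> bool) \<Rightarrow> 'a \<Rightarrow> bool" where
  "quasi_directly_finite R dmd eq z \<longleftrightarrow>
     (\<forall>b\<in>R. (\<exists>a\<in>R. eq (dmd a b) z) \<longrightarrow> (\<exists>c\<in>R. eq (dmd b c) z))"

end

theory Submission
  imports Defs "HOL-Library.Function_Algebras"
begin

text \<open>
  A left quasi-inverse \<open>a\<close> of \<open>b\<close> is also a right quasi-inverse: since \<open>(1 - a)(1 - b) = 1\<close>, it suffices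
  that \<open>1 - a\<close> is injective. Choose \<open>g \<in> C\<^sub>c(G)\<close> so close to \<open>b\<close> that \<open>(1 - a)(1 - g)\<close> is close to \<open>1\<close>; then
  \<open>S = 1 - g\<close> is bounded below, and injectivity of \<open>1 - a\<close> follows once \<open>S\<close> has dense range.
  Put \<open>u = 1 - S\<^sup>*S\<close> and \<open>v = 1 - SS\<^sup>*\<close>, which lie in the convolution algebra \<open>C\<^sub>c(G)\<close>. Unimodularity makes
  \<open>f \<mapsto> f(0)\<close> a trace on \<open>C\<^sub>c(G)\<close>, so \<open>p(u)\<close> and \<open>p(v)\<close> have the same trace, and for real \<open>p\<close> the same
  \<open>L\<^sup>2\<close>-norm, for every polynomial \<open>p\<close> with \<open>p(0) = 0\<close>. For \<open>p(s) = s (1 - t (1 - s))\<^sup>n\<close> and small \<open>t > 0\<close> the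
  lower bound on \<open>S\<^sup>*S\<close> gives \<open>p(u) \<rightarrow> 0\<close> in \<open>L\<^sup>2\<close>, hence \<open>p(v) \<rightarrow> 0\<close>; and \<open>\<eta> - p(v) \<star> \<eta>\<close> is in the range of \<open>S\<close>
  because \<open>1 - p(v)\<close> is divisible by \<open>1 - v = SS\<^sup>*\<close>.
\<close>

subsection \<open>Continuous functions with compact support\<close>

text \<open>Evaluation at the identity is unbounded for the operator norm and makes no sense on the
  whole algebra. Hence \<open>b\<close> is replaced by a nearby \<open>g\<close> in
  \<open>Cc\<close>: a small perturbation keeps an approximate left inverse, hence a lower bound on
  \<open>S\<close>, while \<open>S\<close> moves to where the trace is defined. The polynomial has
  three duties. The factor \<open>s\<close> gives \<open>p(0) = 0\<close>, so \<open>p(u)\<close>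
  and \<open>p(v)\<close> exist without a unit. The value \<open>p(1) = 1\<close> makes
  \<open>1 - p(v)\<close> divisible by \<open>1 - v\<close>. With \<open>q = 1 - s\<close>, the
  factor \<open>(1 - t q)\<^sup>n\<close> tends to 0 uniformly on the spectrum of
  \<open>S\<^sup>*S\<close>, which stays away from 0. The spectrum of \<open>SS\<^sup>*\<close> may
  in addition contain 0, so heuristically \<open>p(v)\<close> tends to the projection onto the
  kernel of \<open>S\<^sup>*\<close>, the complement of the range of \<open>S\<close>; comparing
  traces forces this projection to vanish. Stopping at a finite \<open>n\<close> keeps the argument
  inside \<open>Cc\<close>. The other obstacle is measure-theoretic: the group may fail to be second
  countable or sigma-compact, so interchange of integrals is proved on \<open>Cc\<close> and carried
  to integrable functions by density and Fatou's lemma.\<close>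

definition Cc :: "('a::topological_space \<Rightarrow> complex) \<Rightarrow> bool" where
  "Cc f \<longleftrightarrow> continuous_on UNIV f \<and> (\<exists>K. compact K \<and> (\<forall>x. x \<notin> K \<longrightarrow> f x = 0))"

lemma CcI: "continuous_on UNIV f \<Longrightarrow> compact K \<Longrightarrow> (\<And>x. x \<notin> K \<Longrightarrow> f x = 0) \<Longrightarrow> Cc f"
  by (auto simp: Cc_def)

lemma Cc_continuous: "Cc f \<Longrightarrow> continuous_on UNIV f"
  by (simp add: Cc_def)

lemma Cc_support: "Cc f \<Longrightarrow> \<exists>K. compact K \<and> (\<forall>x. x \<notin> K \<longrightarrow> f x = 0)"
  by (simp add: Cc_def)

lemma Cc_add: "Cc f \<Longrightarrow> Cc g \<Longrightarrow> Cc (\<lambda>x. f x + g x)"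
  unfolding Cc_def by (auto intro!: continuous_intros) (metis UnCI compact_Un add.right_neutral)

lemma Cc_mult_left: "continuous_on UNIV h \<Longrightarrow> Cc f \<Longrightarrow> Cc (\<lambda>x. h x * f x)"
  unfolding Cc_def by (auto intro!: continuous_intros)

lemma Cc_mult_right: "continuous_on UNIV h \<Longrightarrow> Cc f \<Longrightarrow> Cc (\<lambda>x. f x * h x)"
  unfolding Cc_def by (auto intro!: continuous_intros)

lemma Cc_scale: "Cc f \<Longrightarrow> Cc (\<lambda>x. c * f x)"
  by (rule Cc_mult_left) (auto intro!: continuous_intros)

lemma Cc_diff: "Cc f \<Longrightarrow> Cc g \<Longrightarrow> Cc (\<lambda>x. f x - g x)"
  using Cc_add[of f "\<lambda>x. (-1) * g x"] Cc_scale[of g "-1"] by simp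

lemma Cc_image:
  assumes "Cc f" "continuous_on UNIV h" "h 0 = 0"
  shows "Cc (\<lambda>x. h (f x))"
  using assms unfolding Cc_def by (auto intro!: continuous_on_compose2[OF assms(2)])

lemma Cc_homeo:
  assumes "Cc f" "continuous_on UNIV h" "continuous_on UNIV k" "\<And>x. k (h x) = x"
  shows "Cc (\<lambda>x. f (h x))"
proof -
  obtain K where K: "compact K" "\<And>x. x \<notin> K \<Longrightarrow> f x = 0"
    using Cc_support[OF assms(1)] by blast
  show ?thesis
  proof (rule CcI[where K="k ` K"])
    show "continuous_on UNIV (\<lambda>x. f (h x))"
      by (rule continuous_on_compose2[OF Cc_continuous[OF assms(1)] assms(2)]) auto
    show "compact (k ` K)"
      using K(1) assms(3) compact_continuous_image continuous_on_subset by blast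
    show "f (h x) = 0" if "x \<notin> k ` K" for x
      using that assms(4) by (intro K(2)) (metis image_eqI)
  qed
qed

text \<open>The space need not be normal, but a locally compact Hausdorff space is completely
  regular, which separates a compact set from a closed one. Cutting \<open>U\<close> down to a
  relatively compact \<open>V\<close> makes the separating function compactly supported.\<close>

lemma Urysohn_Cc:
  fixes K U :: "'a::t2_space set"
  assumes lc: "locally_compact_space (euclidean :: 'a topology)"
    and K: "compact K" and U: "open U" "K \<subseteq> U"
  obtains f :: "'a \<Rightarrow> real" where "Cc (\<lambda>x. complex_of_real (f x))" "\<And>x. 0 \<le> f x" "\<And>x. f x \<le> 1"
    "\<And>x. x \<in> K \<Longrightarrow> f x = 1" "\<And>x. x \<notin> U \<Longrightarrow> f x = 0"
proof -
  have H: "Hausdorff_space (euclidean :: 'a topology)"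
    by (simp add: Hausdorff_space_def disjnt_def separation_t2)
  have cr: "completely_regular_space (euclidean :: 'a topology)"
    using lc H by (simp add: locally_compact_regular_imp_completely_regular_space)
  obtain V L where V: "open V" "compact L" "K \<subseteq> V" "V \<subseteq> L"
    using locally_compact_space_compact_closed_compact[of "euclidean :: 'a topology"] lc H K
    by auto
  have "closed (- (U \<inter> V))" "disjnt K (- (U \<inter> V))"
    using U V by (auto simp: disjnt_def)
  then obtain f :: "'a \<Rightarrow> real" where f: "continuous_map euclidean (subtopology euclidean {0..1}) f"
    "f ` (- (U \<inter> V)) \<subseteq> {0}" "f ` K \<subseteq> {1}"
    using Urysohn_completely_regular_compact_closed[of 0 1, OF _ cr, of K "- (U \<inter> V)"] K by auto
  have c: "continuous_on UNIV f" and r: "\<And>x. f x \<in> {0..1}"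
    using f(1) by (auto simp: continuous_map_in_subtopology)
  show ?thesis
  proof
    show "Cc (\<lambda>x. complex_of_real (f x))"
      using f(2) V by (intro CcI[where K=L]) (auto intro!: continuous_intros c)
    show "0 \<le> f x" "f x \<le> 1" for x using r[of x] by auto
    show "f x = 1" if "x \<in> K" for x using that f by auto
    show "f x = 0" if "x \<notin> U" for x using that f by auto
  qed
qed

lemma Cc_bounded:
  assumes "Cc f" obtains B where "\<And>x. norm (f x) \<le> B" "B \<ge> 0"
proof -
  obtain K where K: "compact K" "\<And>x. x \<notin> K \<Longrightarrow> f x = 0"
    using Cc_support[OF assms] by blast
  have "compact (f ` K)"
    using K Cc_continuous[OF assms] compact_continuous_image continuous_on_subset by blast
  then obtain B where B: "\<And>x. x \<in> K \<Longrightarrow> norm (f x) \<le> B"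
    by (metis compact_imp_bounded bounded_iff imageI)
  have "norm (f x) \<le> max B 0" for x
    using B[of x] K(2)[of x] by (cases "x \<in> K") auto
  with that show ?thesis by fastforce
qed

section \<open>Integration of compactly supported continuous functions against a measure finite on
  compact sets\<close>

locale radon =
  fixes M :: "'a::t2_space measure"
  assumes sets_M: "sets M = sets borel"
    and compact_finite: "compact K \<Longrightarrow> emeasure M K < \<infinity>"
begin

lemma space_M: "space M = UNIV"
  using sets_eq_imp_space_eq[OF sets_M] by simp

lemma measurable_M: "borel_measurable M = borel_measurable borel"
  by (rule measurable_cong_sets[OF sets_M refl])

lemma compact_sets: "compact K \<Longrightarrow> K \<in> sets M"
  by (simp add: sets_M compact_imp_closed)

lemma open_sets: "open K \<Longrightarrow> K \<in> sets M"
  by (simp add: sets_M)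

lemma continuous_measurable: "continuous_on UNIV f \<Longrightarrow> f \<in> borel_measurable M"
  by (simp add: measurable_M borel_measurable_continuous_onI)

lemma integrable_compact: "compact K \<Longrightarrow> integrable M (\<lambda>x. indicator K x *\<^sub>R c)"
  using compact_finite[of K] compact_sets[of K] by (auto intro!: integrable_scaleR_left integrable_real_indicator)

lemma Cc_integrable: assumes "Cc f" shows "integrable M f"
proof -
  obtain K where K: "compact K" "\<And>x. x \<notin> K \<Longrightarrow> f x = 0"
    using Cc_support[OF assms] by blast
  obtain B where B: "\<And>x. norm (f x) \<le> B" "B \<ge> 0" using Cc_bounded[OF assms] by blast
  show ?thesis
  proof (rule Bochner_Integration.integrable_bound[OF integrable_compact[OF K(1), of B]])
    show "f \<in> borel_measurable M" by (rule continuous_measurable[OF Cc_continuous[OF assms]])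
    show "AE x in M. norm (f x) \<le> norm (indicator K x *\<^sub>R B)"
    proof (rule AE_I2)
      fix x
      show "norm (f x) \<le> norm (indicator K x *\<^sub>R B)"
        using B K by (cases "x \<in> K") auto
    qed
  qed
qed

lemma norm_integral_le_indicator:
  fixes f :: "'a \<Rightarrow> complex"
  assumes "compact K" "\<And>x. norm (f x) \<le> indicator K x * e" "e \<ge> 0"
  shows "norm (\<integral>x. f x \<partial>M) \<le> measure M K * e"
proof -
  have "norm (\<integral>x. f x \<partial>M) \<le> (\<integral>x. indicator K x *\<^sub>R e \<partial>M)"
    using assms by (intro order_trans[OF integral_norm_bound] integral_mono_AE' integrable_compact) auto
  also have "\<dots> = measure M K * e"
    using compact_finite[OF assms(1)] compact_sets[OF assms(1)] by (simp add: space_M)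
  finally show ?thesis .
qed

lemma Cc_slice:
  assumes "continuous_on UNIV F" "compact L" "\<And>x y. y \<notin> L \<Longrightarrow> F (x, y) = 0"
  shows "Cc (\<lambda>y. F (x, y))"
  using assms by (intro CcI[where K=L]) (auto intro!: continuous_on_compose2[OF assms(1)] continuous_intros)

text \<open>Sequences need not detect continuity in the parameter space, so dominated convergence
  does not apply. Instead compactness of \<open>L\<close> makes \<open>F (x, y)\<close> uniformly
  close to \<open>F (x0, y)\<close> for all \<open>y\<close> in \<open>L\<close> (tube
  lemma).\<close>

lemma continuous_parameter_integral:
  fixes F :: "'b::topological_space \<times> 'a \<Rightarrow> complex"
  assumes F: "continuous_on UNIV F" and L: "compact L" "\<And>x y. y \<notin> L \<Longrightarrow> F (x, y) = 0"
  shows "continuous_on UNIV (\<lambda>x. \<integral>y. F (x, y) \<partial>M)"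
  unfolding continuous_on_def
proof (intro ballI tendstoI)
  fix x0 and e :: real assume "0 < e"
  \<comment> \<open>The added 1 keeps the quotient meaningful when \<open>L\<close> is a null
    set.\<close>
  define d where "d = e / (measure M L + 1)"
  have d: "d > 0" "measure M L * d < e"
    using \<open>0 < e\<close> by (auto simp: d_def field_simps add_pos_nonneg add_nonneg_pos)
  have "continuous_on (UNIV \<times> L) F" using F continuous_on_subset by blast
  then obtain X0 where X0: "x0 \<in> X0" "open X0" "\<forall>x\<in>X0 \<inter> UNIV. \<forall>t\<in>L. dist (F (x, t)) (F (x0, t)) \<le> d"
    using continuous_on_prod_compactE[of UNIV L F x0 d] L(1) d(1) by blast
  have i: "integrable M (\<lambda>y. F (x, y))" for x
    by (rule Cc_integrable[OF Cc_slice[OF F L]])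
  have "dist (\<integral>y. F (x, y) \<partial>M) (\<integral>y. F (x0, y) \<partial>M) < e" if "x \<in> X0" for x
  proof -
    have "norm (F (x, y) - F (x0, y)) \<le> indicator L y * d" for y
      using X0(3) that L(2)[of y] by (cases "y \<in> L") (auto simp: dist_norm)
    then have "norm (\<integral>y. F (x, y) - F (x0, y) \<partial>M) \<le> measure M L * d"
      using L(1) d(1) by (intro norm_integral_le_indicator) auto
    then show ?thesis using d(2) i by (simp add: dist_norm)
  qed
  then show "\<forall>\<^sub>F x in at x0 within UNIV. dist (\<integral>y. F (x, y) \<partial>M) (\<integral>y. F (x0, y) \<partial>M) < e"
    using X0 by (auto simp: eventually_at_topological)
qed

text \<open>Only the Borel sigma-algebra on the product, and not the product of the Borel sigma-algebras,
  makes \<open>F\<close> measurable when the space is not second countable, so the product measure cannot be used.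
  Instead \<open>F\<close> is uniformly approximated by finite sums of functions \<open>1\<^sub>B(x) F(x\<^sub>B, y)\<close>.\<close>

lemma Fubini_continuous:
  fixes F :: "'a \<times> 'a \<Rightarrow> complex"
  assumes F: "continuous_on UNIV F" and K: "compact K" "\<And>x y. x \<notin> K \<Longrightarrow> F (x, y) = 0"
    and L: "compact L" "\<And>x y. y \<notin> L \<Longrightarrow> F (x, y) = 0"
  shows "(\<integral>x. \<integral>y. F (x, y) \<partial>M \<partial>M) = (\<integral>y. \<integral>x. F (x, y) \<partial>M \<partial>M)" (is "?A = ?B")
proof -
  define F' where "F' = (\<lambda>(y, x). F (x, y))"
  have F': "continuous_on UNIV F'"
    unfolding F'_def case_prod_beta by (intro continuous_on_compose2[OF F] continuous_intros) auto
  have K': "F' (y, x) = 0" if "x \<notin> K" for x y using that K by (auto simp: F'_def)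
  have F'_eq: "F' (y, x) = F (x, y)" for x y by (simp add: F'_def)
  have sx: "Cc (\<lambda>x. F (x, y))" for y
    using Cc_slice[OF F' K(1) K'] by (simp add: F'_eq)
  have sy: "Cc (\<lambda>y. F (x, y))" for x
    using Cc_slice[OF F L] by simp
  have ix: "Cc (\<lambda>x. \<integral>y. F (x, y) \<partial>M)"
    using continuous_parameter_integral[OF F L] K by (intro CcI[where K=K]) auto
  have iy: "Cc (\<lambda>y. \<integral>x. F (x, y) \<partial>M)"
    using continuous_parameter_integral[OF F' K(1) K'] L by (intro CcI[where K=L]) (auto simp: F'_eq)
  have approx: "norm (?A - ?B) \<le> 2 * measure M K * measure M L * e" if e: "e > 0" for e
  proof -
    have "\<exists>X. x \<in> X \<and> open X \<and> (\<forall>x'\<in>X. \<forall>t\<in>L. norm (F (x', t) - F (x, t)) \<le> e)" for x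
    proof -
      have "continuous_on (UNIV \<times> L) F" using F continuous_on_subset by blast
      then show ?thesis
        using continuous_on_prod_compactE[of UNIV L F x e] L(1) e unfolding dist_norm by (metis IntI UNIV_I)
    qed
    then obtain X where X: "\<And>x. x \<in> X x" "\<And>x. open (X x)"
      "\<And>x x' t. x' \<in> X x \<Longrightarrow> t \<in> L \<Longrightarrow> norm (F (x', t) - F (x, t)) \<le> e"
      by metis
    obtain C where C: "finite C" "K \<subseteq> (\<Union>x\<in>C. X x)"
      using compactE_image[OF K(1), of K X] X by (metis UN_I subsetI)
    obtain h :: "nat \<Rightarrow> 'a" and n where h: "C = h ` {..<n}"
      using finite_imp_nat_seg_image_inj_on[OF C(1)] by (auto simp: lessThan_def)
    define A where "A = (\<lambda>i. K \<inter> X (h i))"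
    \<comment> \<open>Making the cover disjoint leaves exactly one nonzero term in the sum
      \<open>G x y\<close> below when \<open>x\<close> lies in \<open>K\<close>.\<close>
    define E where "E = (\<lambda>i. disjointed A i)"
    have E: "E i \<in> sets M" "E i \<subseteq> K" "E i \<subseteq> X (h i)" for i
    proof -
      have "range A \<subseteq> sets M"
        using K(1) X(2) by (auto simp: A_def compact_sets open_sets)
      then show "E i \<in> sets M" unfolding E_def by (metis sets.range_disjointed_sets range_subsetD)
      show "E i \<subseteq> K" "E i \<subseteq> X (h i)"
        using disjointed_subset[of A i] by (auto simp: E_def A_def)
    qed
    have E_fin: "emeasure M (E i) < \<infinity>" for i
      using compact_finite[OF K(1)] emeasure_mono[OF E(2) compact_sets[OF K(1)]] by (rule le_less_trans[rotated])
    have E_dj: "disjoint_family E"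
      unfolding E_def by (rule disjoint_family_disjointed)
    have E_cover: "\<exists>i<n. x \<in> E i" if "x \<in> K" for x
    proof -
      have "x \<in> (\<Union>i\<in>{..<n}. A i)" using that C h by (auto simp: A_def)
      also have "\<dots> = (\<Union>i\<in>{..<n}. E i)"
        unfolding E_def lessThan_atLeast0 by (rule finite_UN_disjointed_eq[symmetric])
      finally show ?thesis by auto
    qed
    define G where "G = (\<lambda>x y. \<Sum>i<n. indicator (E i) x *\<^sub>R F (h i, y))"
    have G1: "norm (F (x, y) - G x y) \<le> indicator L y * (indicator K x * e)" for x y
    proof (cases "x \<in> K")
      case True
      then obtain i where i: "i < n" "x \<in> E i" using E_cover by blast
      have "indicator (E j) x *\<^sub>R F (h j, y) = (if j = i then F (h j, y) else 0)" for j
        using E_dj i(2) by (auto simp: disjoint_family_on_def indicator_def)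
      then have "G x y = (\<Sum>j<n. if j = i then F (h j, y) else 0)"
        unfolding G_def by (intro sum.cong refl)
      then have "G x y = F (h i, y)"
        using i(1) by simp
      moreover have "x \<in> X (h i)" using i E(3) by blast
      ultimately show ?thesis using X(3)[of x "h i" y] L(2) True by (cases "y \<in> L") auto
    next
      case False
      then have "x \<notin> E i" for i using E(2) by blast
      then show ?thesis using False K(2) by (simp add: G_def)
    qed
    have Gy: "integrable M (\<lambda>y. G x y)" for x
      unfolding G_def by (intro Bochner_Integration.integrable_sum integrable_scaleR_right Cc_integrable sy)
    have Gx: "integrable M (\<lambda>x. G x y)" for y
      unfolding G_def using E E_fin by (intro Bochner_Integration.integrable_sum integrable_scaleR_left integrable_real_indicator)
    \<comment> \<open>Both iterated integrals of \<open>G\<close> equal \<open>I\<close>: each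
      summand is a product of a function of \<open>x\<close> and a function of
      \<open>y\<close>.\<close>
    define I where "I = (\<Sum>i<n. measure M (E i) *\<^sub>R (\<integral>y. F (h i, y) \<partial>M))"
    have iGy: "(\<integral>y. G x y \<partial>M) = (\<Sum>i<n. indicator (E i) x *\<^sub>R (\<integral>y. F (h i, y) \<partial>M))" for x
      unfolding G_def by (subst Bochner_Integration.integral_sum) (auto intro!: integrable_scaleR_right Cc_integrable[OF sy])
    have iGx: "(\<integral>x. G x y \<partial>M) = (\<Sum>i<n. measure M (E i) *\<^sub>R F (h i, y))" for y
      unfolding G_def using E E_fin
      by (subst Bochner_Integration.integral_sum) (auto intro!: integrable_scaleR_left integrable_real_indicator simp: space_M)
    have GA: "integrable M (\<lambda>x. \<integral>y. G x y \<partial>M)" "(\<integral>x. \<integral>y. G x y \<partial>M \<partial>M) = I"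
    proof -
      show "integrable M (\<lambda>x. \<integral>y. G x y \<partial>M)"
        unfolding iGy using E E_fin
        by (intro Bochner_Integration.integrable_sum integrable_scaleR_left integrable_real_indicator)
      show "(\<integral>x. \<integral>y. G x y \<partial>M \<partial>M) = I"
        unfolding iGy I_def using E E_fin
        by (subst Bochner_Integration.integral_sum) (auto intro!: integrable_scaleR_left integrable_real_indicator simp: space_M)
    qed
    have GB: "integrable M (\<lambda>y. \<integral>x. G x y \<partial>M)" "(\<integral>y. \<integral>x. G x y \<partial>M \<partial>M) = I"
    proof -
      show "integrable M (\<lambda>y. \<integral>x. G x y \<partial>M)"
        unfolding iGx by (intro Bochner_Integration.integrable_sum integrable_scaleR_right Cc_integrable[OF sy])
      show "(\<integral>y. \<integral>x. G x y \<partial>M \<partial>M) = I"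
        unfolding iGx I_def
        by (subst Bochner_Integration.integral_sum) (auto intro!: integrable_scaleR_right Cc_integrable[OF sy])
    qed
    have "norm ((\<integral>y. F (x, y) \<partial>M) - (\<integral>y. G x y \<partial>M)) \<le> indicator K x * (measure M L * e)" for x
    proof -
      have "norm (\<integral>y. F (x, y) - G x y \<partial>M) \<le> measure M L * (indicator K x * e)"
        using L e G1 by (intro norm_integral_le_indicator) auto
      then show ?thesis using Gy Cc_integrable[OF sy] by (simp add: algebra_simps)
    qed
    then have "norm (\<integral>x. (\<integral>y. F (x, y) \<partial>M) - (\<integral>y. G x y \<partial>M) \<partial>M) \<le> measure M K * (measure M L * e)"
      using K e by (intro norm_integral_le_indicator) auto
    then have a: "norm (?A - I) \<le> measure M K * (measure M L * e)"
      using GA Cc_integrable[OF ix] by simp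
    have "norm ((\<integral>x. F (x, y) \<partial>M) - (\<integral>x. G x y \<partial>M)) \<le> indicator L y * (measure M K * e)" for y
    proof -
      have "norm (\<integral>x. F (x, y) - G x y \<partial>M) \<le> measure M K * (indicator L y * e)"
        using K e G1[of _ y] by (intro norm_integral_le_indicator) (auto simp: algebra_simps)
      then show ?thesis using Gx Cc_integrable[OF sx] by (simp add: algebra_simps)
    qed
    then have "norm (\<integral>y. (\<integral>x. F (x, y) \<partial>M) - (\<integral>x. G x y \<partial>M) \<partial>M) \<le> measure M L * (measure M K * e)"
      using L e by (intro norm_integral_le_indicator) auto
    then have "norm (?B - I) \<le> measure M L * (measure M K * e)"
      using GB Cc_integrable[OF iy] by simp
    with a have "norm ((?A - I) - (?B - I)) \<le> 2 * (measure M K * (measure M L * e))"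
      using norm_triangle_ineq4[of "?A - I" "?B - I"] by (simp add: algebra_simps)
    then show ?thesis by (simp add: algebra_simps)
  qed
  define m where "m = 2 * measure M K * measure M L"
  have "norm (?A - ?B) \<le> 0"
  proof (rule field_le_epsilon)
    fix e :: real assume "0 < e"
    have m0: "m \<ge> 0" by (simp add: m_def)
    then have "0 < e / (m + 1)" using \<open>0 < e\<close> by (intro divide_pos_pos) auto
    from approx[OF this] have "norm (?A - ?B) \<le> m * (e / (m + 1))"
      by (simp add: m_def)
    also have "\<dots> \<le> e" using m0 \<open>0 < e\<close> by (simp add: field_simps)
    finally show "norm (?A - ?B) \<le> 0 + e" by simp
  qed
  then show ?thesis by simp
qed

end

subsection \<open>Unimodular Haar measure\<close>

lemma measure_preserving_integral:
  fixes f :: "'a \<Rightarrow> 'b::{banach,second_countable_topology}"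
  assumes T: "T \<in> measurable M M" "distr M M T = M"
    and f: "f \<in> borel_measurable M"
  shows "(\<integral>x. f (T x) \<partial>M) = (\<integral>x. f x \<partial>M)"
  using integral_distr[OF T(1) f] by (simp add: T(2))

lemma measure_preserving_AE:
  assumes T: "T \<in> measurable M M" "distr M M T = M" and "AE x in M. P x"
  shows "AE x in M. P (T x)"
  by (rule AE_distrD[OF T(1)]) (simp only: T(2) assms(3))

locale unimodular_haar =
  fixes \<mu> :: "'g::{topological_group_add,t2_space} measure"
  assumes loc: "locally_compact_group TYPE('g)"
    and haar: "left_haar_measure \<mu>"
    and right_inv: "right_invariant \<mu>"
begin

sublocale radon \<mu>
  using haar by unfold_locales (auto simp: left_haar_measure_def)

lemma lc: "locally_compact_space (euclidean :: 'g topology)"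
  using loc by (simp add: locally_compact_group_def)

lemma outer_regular: "A \<in> sets borel \<Longrightarrow> emeasure \<mu> A = (INF U\<in>{U. open U \<and> A \<subseteq> U}. emeasure \<mu> U)"
  using haar by (auto simp: left_haar_measure_def)

lemma inner_regular: "open U \<Longrightarrow> emeasure \<mu> U = (SUP K\<in>{K. compact K \<and> K \<subseteq> U}. emeasure \<mu> K)"
  using haar by (auto simp: left_haar_measure_def)

lemma measurable_continuous: "continuous_on UNIV T \<Longrightarrow> T \<in> measurable \<mu> \<mu>" for T :: "'g \<Rightarrow> 'g"
  using measurable_cong_sets[OF sets_M sets_M] borel_measurable_continuous_onI by blast

text \<open>Haar invariance is stated through images of sets and push-forwards through preimages;
  for a homeomorphism the preimage is the image under the inverse \<open>T'\<close>.\<close>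

lemma distr_eqI:
  assumes "continuous_on UNIV T" "continuous_on UNIV T'" "\<And>x. T' (T x) = x" "\<And>x. T (T' x) = x"
    "\<And>A. A \<in> sets borel \<Longrightarrow> emeasure \<mu> (T' ` A) = emeasure \<mu> A"
  shows "distr \<mu> \<mu> T = \<mu>"
proof (rule measure_eqI)
  fix A assume "A \<in> sets (distr \<mu> \<mu> T)"
  then have A: "A \<in> sets \<mu>" by simp
  have "T -` A = T' ` A" using assms(3,4) by (auto simp: image_iff) (metis)+
  then show "emeasure (distr \<mu> \<mu> T) A = emeasure \<mu> A"
    using A assms(5)[of A] by (simp add: emeasure_distr[OF measurable_continuous[OF assms(1)]] space_M sets_M)
qed simp

lemma left_translation: "(\<lambda>x. g + x) \<in> measurable \<mu> \<mu>" "distr \<mu> \<mu> (\<lambda>x. g + x) = \<mu>"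
proof -
  show "(\<lambda>x. g + x) \<in> measurable \<mu> \<mu>"
    by (intro measurable_continuous continuous_intros)
  show "distr \<mu> \<mu> (\<lambda>x. g + x) = \<mu>"
    using haar by (intro distr_eqI[where T'="\<lambda>x. - g + x"] continuous_intros)
      (auto simp: left_haar_measure_def add.assoc[symmetric])
qed

lemma right_translation: "(\<lambda>x. x + g) \<in> measurable \<mu> \<mu>" "distr \<mu> \<mu> (\<lambda>x. x + g) = \<mu>"
proof -
  show "(\<lambda>x. x + g) \<in> measurable \<mu> \<mu>"
    by (intro measurable_continuous continuous_intros)
  show "distr \<mu> \<mu> (\<lambda>x. x + g) = \<mu>"
    using right_inv sets_M by (intro distr_eqI[where T'="\<lambda>x. x + (- g)"] continuous_intros)
      (auto simp: right_invariant_def add.assoc simp del: add_uminus_conv_diff)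
qed

lemma Cc_measurable: "Cc f \<Longrightarrow> f \<in> borel_measurable \<mu>"
  by (rule continuous_measurable[OF Cc_continuous])

lemma Cc_inverse: "Cc f \<Longrightarrow> Cc (\<lambda>x. f (- x))" for f :: "'g \<Rightarrow> complex"
  by (rule Cc_homeo[where k=uminus]) (auto intro!: continuous_intros)

text \<open>Sandwiches a function of \<open>Cc\<close> between the indicators of \<open>K\<close>
  and \<open>U\<close>. This transfers facts about integrals on \<open>Cc\<close> to measures of
  sets, where regularity takes over.\<close>

lemma Urysohn_integral:
  assumes "compact K" "open U" "K \<subseteq> U"
  shows "\<exists>f :: 'g \<Rightarrow> real. Cc (\<lambda>x. complex_of_real (f x)) \<and> (\<forall>x. 0 \<le> f x \<and> f x \<le> 1) \<and>
    (\<forall>x. x \<notin> U \<longrightarrow> f x = 0) \<and> (\<forall>x\<in>K. f x = 1) \<and>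
    integrable \<mu> f \<and> emeasure \<mu> K \<le> ennreal (\<integral>x. f x \<partial>\<mu>)"
proof -
  obtain f :: "'g \<Rightarrow> real" where f: "Cc (\<lambda>x. complex_of_real (f x))" "\<And>x. 0 \<le> f x" "\<And>x. f x \<le> 1"
    "\<And>x. x \<in> K \<Longrightarrow> f x = 1" "\<And>x. x \<notin> U \<Longrightarrow> f x = 0"
    using Urysohn_Cc[OF lc assms] by blast
  have i: "integrable \<mu> f"
    using integrable_Re[OF Cc_integrable[OF f(1)]] by simp
  have "emeasure \<mu> K = (\<integral>\<^sup>+x. indicator K x \<partial>\<mu>)"
    using compact_sets[OF assms(1)] by simp
  also have "\<dots> \<le> (\<integral>\<^sup>+x. ennreal (f x) \<partial>\<mu>)"
    using f by (intro nn_integral_mono) (auto simp: indicator_def)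
  also have "\<dots> = ennreal (\<integral>x. f x \<partial>\<mu>)"
    using i f by (intro nn_integral_eq_integral) auto
  finally show ?thesis using f i by blast
qed

text \<open>Supplies a factor to cancel in the next lemma. A nonzero measure is nonzero on some
  compact set by inner regularity of the whole group.\<close>

lemma Cc_nonzero_integral:
  obtains f where "Cc f" "(\<integral>x. f x \<partial>\<mu>) \<noteq> 0"
proof -
  have "(SUP K\<in>{K. compact K \<and> K \<subseteq> UNIV}. emeasure \<mu> K) \<noteq> 0"
    using inner_regular[of UNIV] haar by (auto simp: left_haar_measure_def)
  then obtain K where K: "compact K" "emeasure \<mu> K \<noteq> 0"
    by (metis (no_types, lifting) SUP_eq_const SUP_const bot_ennreal SUP_bot_conv(1) mem_Collect_eq)
  obtain f :: "'g \<Rightarrow> real" where f: "Cc (\<lambda>x. complex_of_real (f x))" "emeasure \<mu> K \<le> ennreal (\<integral>x. f x \<partial>\<mu>)"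
    using Urysohn_integral[OF K(1), of UNIV] by auto
  have "(\<integral>x. f x \<partial>\<mu>) \<noteq> 0" using f(2) K(2) by auto
  with f(1) that show ?thesis by (metis integral_complex_of_real of_real_eq_0_iff)
qed

text \<open>For a bi-invariant measure, \<open>\<integral>f(x) dx \<integral>g(-y) dy = \<integral>f(-x) dx \<integral>g(-y) dy\<close>, since both sides
  are \<open>\<integral>\<integral> f(x) g(-y-x) dx dy\<close>.\<close>

lemma Cc_integral_inverse:
  assumes f: "Cc f"
  shows "(\<integral>x. f (- x) \<partial>\<mu>) = (\<integral>x. f x \<partial>\<mu>)"
proof -
  obtain g0 where g0: "Cc g0" "(\<integral>x. g0 x \<partial>\<mu>) \<noteq> 0" using Cc_nonzero_integral .
  \<comment> \<open>Reflected so that the factor cancelled at the end, the integral of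
    \<open>g (- x)\<close>, is the nonzero one.\<close>
  define g where "g = (\<lambda>x. g0 (- x))"
  have g: "Cc g" "(\<integral>x. g (- x) \<partial>\<mu>) \<noteq> 0" using Cc_inverse[OF g0(1)] g0 by (auto simp: g_def)
  obtain K where K: "compact K" "\<And>x. x \<notin> K \<Longrightarrow> f x = 0" using Cc_support[OF f] by blast
  obtain L where L: "compact L" "\<And>x. x \<notin> L \<Longrightarrow> g x = 0" using Cc_support[OF g(1)] by blast
  define F where "F = (\<lambda>(x, y). f x * g (- y - x))"
  define N where "N = (\<lambda>(l, x). - (l + x)) ` (L \<times> K)"
  have N: "compact N"
    unfolding N_def case_prod_beta by (intro compact_continuous_image compact_Times K L continuous_intros)
  have Fc: "continuous_on UNIV F"
    unfolding F_def case_prod_beta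
    by (intro continuous_intros continuous_on_compose2[OF Cc_continuous[OF f]] continuous_on_compose2[OF Cc_continuous[OF g(1)]]) auto
  have FN: "F (x, y) = 0" if "y \<notin> N" for x y
  proof (cases "x \<in> K \<and> - y - x \<in> L")
    case True
    then have "- ((- y - x) + x) \<in> N" unfolding N_def by force
    then show ?thesis using that by simp
  qed (auto simp: F_def K L)
  have FK: "F (x, y) = 0" if "x \<notin> K" for x y using that K by (simp add: F_def)
  have gm: "(\<lambda>y. g (- y)) \<in> borel_measurable \<mu>" by (intro Cc_measurable Cc_inverse g)
  have fm: "(\<lambda>y. f (- y)) \<in> borel_measurable \<mu>" by (intro Cc_measurable Cc_inverse f)
  have "(\<integral>y. g (- y - x) \<partial>\<mu>) = (\<integral>y. g (- y) \<partial>\<mu>)" for x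
    using measure_preserving_integral[OF left_translation[of x] gm] by (simp add: minus_add)
  then have A: "(\<integral>x. \<integral>y. F (x, y) \<partial>\<mu> \<partial>\<mu>) = (\<integral>x. f x \<partial>\<mu>) * (\<integral>y. g (- y) \<partial>\<mu>)"
    by (simp add: F_def)
  \<comment> \<open>\<open>F'\<close> is \<open>F\<close> after the right translation replacing
    \<open>x\<close> by \<open>x - y\<close>. A second interchange then integrates
    \<open>f (x - y)\<close> over \<open>y\<close> first, and right invariance turns that into the
    integral of \<open>f (- y)\<close>.\<close>
  define F' where "F' = (\<lambda>(x, y). f (x - y) * g (- x))"
  have F'c: "continuous_on UNIV F'"
    unfolding F'_def case_prod_beta
    by (intro continuous_intros continuous_on_compose2[OF Cc_continuous[OF f]] continuous_on_compose2[OF Cc_continuous[OF g(1)]]) auto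
  define N1 where "N1 = uminus ` L"
  define N2 where "N2 = (\<lambda>(l, x). - l + x) ` (K \<times> N1)"
  have N1: "compact N1"
    unfolding N1_def by (intro compact_continuous_image L continuous_intros)
  have N2: "compact N2"
    unfolding N2_def case_prod_beta by (intro compact_continuous_image compact_Times K N1 continuous_intros)
  have F'N1: "F' (x, y) = 0" if "x \<notin> N1" for x y
  proof -
    have "- x \<notin> L" using that unfolding N1_def by (metis image_eqI minus_minus)
    then show ?thesis using L(2) by (simp add: F'_def)
  qed
  have F'N2: "F' (x, y) = 0" if "y \<notin> N2" for x y
  proof (cases "x \<in> N1 \<and> x - y \<in> K")
    case True
    then have "- (x - y) + x \<in> N2" unfolding N2_def by force
    then show ?thesis using that by (simp add: minus_diff_eq)
  qed (use F'N1 K in \<open>auto simp: F'_def\<close>)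
  have "(\<integral>x. F (x, y) \<partial>\<mu>) = (\<integral>x. F' (x, y) \<partial>\<mu>)" for y
  proof -
    have "Cc (\<lambda>x. F (x, y))"
      unfolding F_def prod.case
      by (intro Cc_mult_right f continuous_on_compose2[OF Cc_continuous[OF g(1)]] continuous_intros) auto
    from measure_preserving_integral[OF right_translation[of "- y"] Cc_measurable[OF this]]
    show ?thesis by (simp add: F_def F'_def minus_diff_eq diff_diff_eq2)
  qed
  then have "(\<integral>y. \<integral>x. F (x, y) \<partial>\<mu> \<partial>\<mu>) = (\<integral>x. \<integral>y. F' (x, y) \<partial>\<mu> \<partial>\<mu>)"
    using Fubini_continuous[OF F'c N1 F'N1 N2 F'N2] by simp
  also have "(\<integral>y. f (x - y) \<partial>\<mu>) = (\<integral>y. f (- y) \<partial>\<mu>)" for x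
    using measure_preserving_integral[OF right_translation[of "- x"] fm] by simp
  then have "(\<integral>x. \<integral>y. F' (x, y) \<partial>\<mu> \<partial>\<mu>) = (\<integral>y. f (- y) \<partial>\<mu>) * (\<integral>x. g (- x) \<partial>\<mu>)"
    by (simp add: F'_def)
  finally have "(\<integral>x. f x \<partial>\<mu>) * (\<integral>y. g (- y) \<partial>\<mu>) = (\<integral>y. f (- y) \<partial>\<mu>) * (\<integral>x. g (- x) \<partial>\<mu>)"
    using A Fubini_continuous[where F=F, OF Fc K(1) _ N] FK FN by auto
  then show ?thesis using g(2) by simp
qed

text \<open>An Urysohn function \<open>f\<close> between \<open>K\<close> and \<open>U\<close> has
  the same integral as its reflection, which is at most the indicator of \<open>- U\<close>; the
  supremum over \<open>K\<close> gives one inequality. The other follows because inversion is an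
  involution.\<close>

lemma emeasure_inverse_open:
  assumes U: "open U" shows "emeasure \<mu> (uminus ` U) = emeasure \<mu> U"
proof -
  have op: "open (uminus ` U)" if "open U" for U :: "'g set"
  proof -
    have "uminus ` U = uminus -` U" by force
    moreover have "open (uminus -` U)"
      using that by (rule open_vimage) (intro continuous_intros)
    ultimately show ?thesis by simp
  qed
  have le: "emeasure \<mu> U \<le> emeasure \<mu> (uminus ` U)" if U: "open U" for U
    unfolding inner_regular[OF U]
  proof (rule SUP_least)
    fix K assume "K \<in> {K. compact K \<and> K \<subseteq> U}"
    then have "compact K" "K \<subseteq> U" by auto
    then obtain f :: "'g \<Rightarrow> real" where f: "Cc (\<lambda>x. complex_of_real (f x))" "\<And>x. 0 \<le> f x" "\<And>x. f x \<le> 1"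
      "\<And>x. x \<notin> U \<Longrightarrow> f x = 0" "integrable \<mu> f" "emeasure \<mu> K \<le> ennreal (\<integral>x. f x \<partial>\<mu>)"
      using Urysohn_integral[OF _ U, of K] by blast
    have i: "integrable \<mu> (\<lambda>x. f (- x))"
      using integrable_Re[OF Cc_integrable[OF Cc_inverse[OF f(1)]]] by simp
    have "(\<integral>x. f x \<partial>\<mu>) = (\<integral>x. f (- x) \<partial>\<mu>)"
      using Cc_integral_inverse[OF f(1)] by simp
    then have "ennreal (\<integral>x. f x \<partial>\<mu>) = (\<integral>\<^sup>+x. ennreal (f (- x)) \<partial>\<mu>)"
      using i f(2) by (simp add: nn_integral_eq_integral)
    also have "\<dots> \<le> (\<integral>\<^sup>+x. indicator (uminus ` U) x \<partial>\<mu>)"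
    proof (intro nn_integral_mono)
      fix x
      show "ennreal (f (- x)) \<le> indicator (uminus ` U) x"
        using f(3)[of "- x"] f(4)[of "- x"] image_eqI[of x uminus "- x" U] by (cases "- x \<in> U") auto
    qed
    also have "\<dots> = emeasure \<mu> (uminus ` U)"
      using open_sets[OF op[OF U]] by simp
    finally show "emeasure \<mu> K \<le> emeasure \<mu> (uminus ` U)" using f(6) by simp
  qed
  show ?thesis
    using le[OF U] le[OF op[OF U]] by (simp add: image_image)
qed

text \<open>Outer regularity carries the statement from open to Borel sets, as \<open>- U\<close>
  covers \<open>- A\<close> whenever \<open>U\<close> covers \<open>A\<close>. One inequality again
  suffices for an involution.\<close>

lemma inversion: "uminus \<in> measurable \<mu> \<mu>" "distr \<mu> \<mu> uminus = \<mu>"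
proof -
  show m: "uminus \<in> measurable \<mu> \<mu>"
    by (intro measurable_continuous continuous_intros)
  have bor: "uminus ` A \<in> sets borel" if "A \<in> sets borel" for A :: "'g set"
  proof -
    have "uminus ` A = uminus -` A" by force
    then show ?thesis using measurable_sets[OF m, of A] that by (simp add: sets_M space_M)
  qed
  have le: "emeasure \<mu> (uminus ` A) \<le> emeasure \<mu> A" if A: "A \<in> sets borel" for A
    unfolding outer_regular[OF A]
  proof (rule INF_greatest)
    fix U assume U: "U \<in> {U. open U \<and> A \<subseteq> U}"
    have "emeasure \<mu> (uminus ` A) \<le> emeasure \<mu> (uminus ` U)"
      using U bor[of U] by (intro emeasure_mono) (auto simp: sets_M)
    then show "emeasure \<mu> (uminus ` A) \<le> emeasure \<mu> U"
      using U emeasure_inverse_open by auto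
  qed
  have eq: "emeasure \<mu> (uminus ` A) = emeasure \<mu> A" if A: "A \<in> sets borel" for A
    using le[OF A] le[OF bor[OF A]] by (simp add: image_image)
  show "distr \<mu> \<mu> uminus = \<mu>"
    by (rule distr_eqI[where T'=uminus]) (auto intro!: continuous_intros simp: eq)
qed

end

subsection \<open>The convolution algebra\<close>

text \<open>The involution corresponding to the operator adjoint of convolution by \<open>f\<close>;
  its usual modular factor is 1 on a unimodular group.\<close>

definition star :: "('g::group_add \<Rightarrow> complex) \<Rightarrow> 'g \<Rightarrow> complex" where
  "star f = (\<lambda>x. cnj (f (- x)))"

definition scal :: "complex \<Rightarrow> ('a \<Rightarrow> complex) \<Rightarrow> 'a \<Rightarrow> complex" where
  "scal c f = (\<lambda>x. c * f x)"

lemma scal_diff: "scal c (f - h) = scal c f - scal c h"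
  by (simp add: scal_def fun_eq_iff algebra_simps)

lemma star_star: "star (star f) = f"
  by (simp add: star_def)

lemma star_add: "star (f + h) = star f + star h"
  by (simp add: star_def fun_eq_iff)

lemma star_diff: "star (f - h) = star f - star h"
  by (simp add: star_def fun_eq_iff)

lemma star_scal: "star (scal c f) = scal (cnj c) (star f)"
  by (simp add: star_def scal_def fun_eq_iff)

lemma Cc_plus: "Cc f \<Longrightarrow> Cc h \<Longrightarrow> Cc (f + h)"
  by (simp add: plus_fun_def Cc_add)

lemma Cc_minus: "Cc f \<Longrightarrow> Cc h \<Longrightarrow> Cc (f - h)"
  using Cc_diff[of f h] by (simp add: fun_diff_def)

lemma Cc_scal: "Cc f \<Longrightarrow> Cc (scal c f)"
  by (simp add: scal_def Cc_scale)

context unimodular_haar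
begin

abbreviation conv :: "('g \<Rightarrow> complex) \<Rightarrow> ('g \<Rightarrow> complex) \<Rightarrow> 'g \<Rightarrow> complex" (infixr "\<star>" 75) where
  "f \<star> h \<equiv> left_reg \<mu> f h"

lemma Cc_star: "Cc f \<Longrightarrow> Cc (star f)" for f :: "'g \<Rightarrow> complex"
  unfolding star_def by (intro Cc_image[where h=cnj] Cc_inverse continuous_intros) auto

lemma Cc_conv_integrand:
  fixes f h :: "'g \<Rightarrow> complex"
  assumes "Cc f" "Cc h" shows "Cc (\<lambda>y. f y * h (- y + x))"
  by (intro Cc_mult_right assms continuous_on_compose2[OF Cc_continuous[OF assms(2)]] continuous_intros) auto

lemmas conv_integrable = Cc_integrable[OF Cc_conv_integrand]

lemma conv_pair_continuous:
  fixes f h :: "'g \<Rightarrow> complex"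
  assumes "Cc f" "Cc h" shows "continuous_on UNIV (\<lambda>(x, y). f y * h (- y + x))"
  unfolding case_prod_beta
  by (intro continuous_intros continuous_on_compose2[OF Cc_continuous[OF assms(1)]] continuous_on_compose2[OF Cc_continuous[OF assms(2)]]) auto

lemma conv_pair_support:
  fixes f h :: "'g \<Rightarrow> complex"
  assumes "Cc f" "Cc h"
  obtains K L where "compact K" "compact L" "\<And>x y. y \<notin> K \<Longrightarrow> f y * h (- y + x) = 0"
    "\<And>x y. x \<notin> L \<Longrightarrow> f y * h (- y + x) = 0"
proof -
  obtain K where K: "compact K" "\<And>x. x \<notin> K \<Longrightarrow> f x = 0" using Cc_support[OF assms(1)] by blast
  obtain L where L: "compact L" "\<And>x. x \<notin> L \<Longrightarrow> h x = 0" using Cc_support[OF assms(2)] by blast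
  define N where "N = (\<lambda>(k, l). k + l) ` (K \<times> L)"
  have N: "compact N"
    unfolding N_def case_prod_beta by (intro compact_continuous_image compact_Times K L continuous_intros)
  have "f y * h (- y + x) = 0" if "x \<notin> N" for x y
  proof (cases "y \<in> K \<and> - y + x \<in> L")
    case True
    then have "y + (- y + x) \<in> N" unfolding N_def by force
    then show ?thesis using that by (simp add: add.assoc[symmetric])
  qed (auto simp: K L)
  then show ?thesis using that[OF K(1) N] K(2) by auto
qed

lemma Cc_conv: assumes "Cc f" "Cc h" shows "Cc (f \<star> h)"
proof -
  obtain K L where KL: "compact K" "compact L" "\<And>x y. y \<notin> K \<Longrightarrow> f y * h (- y + x) = 0"
    "\<And>x y. x \<notin> L \<Longrightarrow> f y * h (- y + x) = 0"
    using conv_pair_support[OF assms] by blast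
  have "continuous_on UNIV (f \<star> h)"
    using continuous_parameter_integral[OF conv_pair_continuous[OF assms] KL(1)] KL(3)
    by (simp add: left_reg_def)
  then show ?thesis
    by (rule CcI[OF _ KL(2)]) (simp add: left_reg_def KL(4))
qed

text \<open>For nonnegative functions this computes the \<open>L\<^sup>1\<close> norm of a
  convolution exactly, which is what Young's inequality is built on below.\<close>

lemma integral_conv:
  assumes "Cc f" "Cc h" shows "(\<integral>x. (f \<star> h) x \<partial>\<mu>) = (\<integral>x. f x \<partial>\<mu>) * (\<integral>x. h x \<partial>\<mu>)"
proof -
  obtain K L where KL: "compact K" "compact L" "\<And>x y. y \<notin> K \<Longrightarrow> f y * h (- y + x) = 0"
    "\<And>x y. x \<notin> L \<Longrightarrow> f y * h (- y + x) = 0"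
    using conv_pair_support[OF assms] by blast
  have "(\<integral>x. (f \<star> h) x \<partial>\<mu>) = (\<integral>y. \<integral>x. f y * h (- y + x) \<partial>\<mu> \<partial>\<mu>)"
    using Fubini_continuous[OF conv_pair_continuous[OF assms] KL(2) _ KL(1)] KL(3,4) by (simp add: left_reg_def)
  also have "\<dots> = (\<integral>y. f y * (\<integral>x. h x \<partial>\<mu>) \<partial>\<mu>)"
    using measure_preserving_integral[OF left_translation Cc_measurable[OF assms(2)]] by simp
  finally show ?thesis by simp
qed

lemma conv_assoc:
  assumes "Cc f" "Cc g" "Cc h" shows "(f \<star> g) \<star> h = f \<star> (g \<star> h)"
proof
  fix x
  obtain K L where KL: "compact K" "compact L" "\<And>x y. y \<notin> K \<Longrightarrow> f y * g (- y + x) = 0"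
    "\<And>x y. x \<notin> L \<Longrightarrow> f y * g (- y + x) = 0"
    using conv_pair_support[OF assms(1,2)] by blast
  define F where "F = (\<lambda>(w, y). f y * g (- y + w) * h (- w + x))"
  have Fc: "continuous_on UNIV F"
    unfolding F_def case_prod_beta
    by (intro continuous_intros continuous_on_compose2[OF Cc_continuous[OF assms(1)]]
          continuous_on_compose2[OF Cc_continuous[OF assms(2)]]
          continuous_on_compose2[OF Cc_continuous[OF assms(3)]]) auto
  have "((f \<star> g) \<star> h) x = (\<integral>w. \<integral>y. F (w, y) \<partial>\<mu> \<partial>\<mu>)"
    by (simp add: left_reg_def F_def)
  also have "\<dots> = (\<integral>y. \<integral>w. F (w, y) \<partial>\<mu> \<partial>\<mu>)"
    by (rule Fubini_continuous[OF Fc KL(2) _ KL(1)]) (simp_all only: F_def prod.case KL(3,4) mult_zero_left not_False_eq_True)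
  also have "\<dots> = (\<integral>y. f y * (g \<star> h) (- y + x) \<partial>\<mu>)"
  proof (rule Bochner_Integration.integral_cong[OF refl])
    fix y
    have "(g \<star> h) (- y + x) = (\<integral>z. g (- y + z) * h (- (- y + z) + (- y + x)) \<partial>\<mu>)"
      using measure_preserving_integral[OF left_translation Cc_measurable[OF Cc_conv_integrand[OF assms(2,3)]], of "- y" "- y + x"]
      by (simp add: left_reg_def)
    also have "\<dots> = (\<integral>z. g (- y + z) * h (- z + x) \<partial>\<mu>)"
      by (simp add: minus_add add.assoc)
    finally show "(\<integral>w. F (w, y) \<partial>\<mu>) = f y * (g \<star> h) (- y + x)"
      by (simp add: F_def mult.assoc)
  qed
  finally show "((f \<star> g) \<star> h) x = (f \<star> (g \<star> h)) x"
    by (simp add: left_reg_def)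
qed

lemma star_conv:
  assumes "Cc f" "Cc h" shows "star (f \<star> h) = star h \<star> star f"
proof
  fix x
  have "(star h \<star> star f) x = (\<integral>y. cnj (h (- y)) * cnj (f (- (- y + x))) \<partial>\<mu>)"
    by (simp add: left_reg_def star_def)
  also have "\<dots> = (\<integral>y. cnj (h (- (x + y))) * cnj (f (- (- (x + y) + x))) \<partial>\<mu>)"
    using measure_preserving_integral[OF left_translation Cc_measurable[OF Cc_conv_integrand[OF Cc_star[OF assms(2)] Cc_star[OF assms(1)]]], of x x]
    by (simp add: star_def)
  also have "\<dots> = (\<integral>y. cnj (f y * h (- y + (- x))) \<partial>\<mu>)"
    by (simp add: minus_add add.assoc mult.commute)
  also have "\<dots> = star (f \<star> h) x"
    unfolding left_reg_def star_def by (rule Bochner_Integration.integral_cnj)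
  finally show "star (f \<star> h) x = (star h \<star> star f) x" ..
qed

text \<open>Both sides integrate \<open>f y * h (- y)\<close> up to the substitution of
  \<open>- y\<close> for \<open>y\<close>. Unimodularity enters through invariance under
  inversion.\<close>

lemma conv_trace:
  assumes "Cc f" "Cc h" shows "(f \<star> h) 0 = (h \<star> f) 0"
  using measure_preserving_integral[OF inversion Cc_measurable[OF Cc_conv_integrand[OF assms]], of 0]
  by (simp add: left_reg_def mult.commute)

lemma conv_add_left: "Cc f \<Longrightarrow> Cc f' \<Longrightarrow> Cc h \<Longrightarrow> (f + f') \<star> h = f \<star> h + f' \<star> h"
  by (simp add: left_reg_def fun_eq_iff distrib_right Bochner_Integration.integral_add conv_integrable)

lemma conv_diff_left: "Cc f \<Longrightarrow> Cc f' \<Longrightarrow> Cc h \<Longrightarrow> (f - f') \<star> h = f \<star> h - f' \<star> h"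
  by (simp add: left_reg_def fun_eq_iff left_diff_distrib Bochner_Integration.integral_diff conv_integrable)

lemma conv_add_right: "Cc f \<Longrightarrow> Cc h \<Longrightarrow> Cc h' \<Longrightarrow> f \<star> (h + h') = f \<star> h + f \<star> h'"
  by (simp add: left_reg_def fun_eq_iff distrib_left Bochner_Integration.integral_add conv_integrable)

lemma conv_diff_right: "Cc f \<Longrightarrow> Cc h \<Longrightarrow> Cc h' \<Longrightarrow> f \<star> (h - h') = f \<star> h - f \<star> h'"
  by (simp add: left_reg_def fun_eq_iff right_diff_distrib Bochner_Integration.integral_diff conv_integrable)

lemma conv_scal_left: "scal c f \<star> h = scal c (f \<star> h)"
  by (simp add: left_reg_def scal_def fun_eq_iff mult.assoc)

lemma conv_scal_right: "f \<star> scal c h = scal c (f \<star> h)"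
  by (simp add: left_reg_def scal_def fun_eq_iff mult.left_commute)

lemmas conv_simps = conv_add_left conv_add_right conv_diff_left conv_diff_right conv_scal_left conv_scal_right
lemmas Cc_closed = Cc_plus Cc_minus Cc_scal Cc_star Cc_conv

end

subsection \<open>Square-integrable functions\<close>

lemma L2_norm_nonneg: "0 \<le> L2_norm M f"
  by (simp add: L2_norm_def)

lemma L2_norm_sq: "(L2_norm M f)\<^sup>2 = (\<integral>x. (cmod (f x))\<^sup>2 \<partial>M)"
  by (simp add: L2_norm_def)

lemma L2_product_integrable:
  assumes "L2 M f" "L2 M g" shows "integrable M (\<lambda>x. cmod (f x) * cmod (g x))"
proof (rule Bochner_Integration.integrable_bound[where f="\<lambda>x. (cmod (f x))\<^sup>2 + (cmod (g x))\<^sup>2"])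
  show "integrable M (\<lambda>x. (cmod (f x))\<^sup>2 + (cmod (g x))\<^sup>2)"
    using assms by (auto simp: L2_def)
  show "(\<lambda>x. cmod (f x) * cmod (g x)) \<in> borel_measurable M"
    using assms by (auto simp: L2_def)
  show "AE x in M. norm (cmod (f x) * cmod (g x)) \<le> norm ((cmod (f x))\<^sup>2 + (cmod (g x))\<^sup>2)"
  proof (rule AE_I2)
    fix x
    have "cmod (f x) * cmod (g x) \<le> 2 * cmod (f x) * cmod (g x)" by simp
    also have "\<dots> \<le> (cmod (f x))\<^sup>2 + (cmod (g x))\<^sup>2" by (rule sum_squares_bound)
    finally show "norm (cmod (f x) * cmod (g x)) \<le> norm ((cmod (f x))\<^sup>2 + (cmod (g x))\<^sup>2)" by simp
  qed
qed

lemma L2_Cauchy_Schwarz: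
  assumes "L2 M f" "L2 M g" shows "(\<integral>x. cmod (f x) * cmod (g x) \<partial>M) \<le> L2_norm M f * L2_norm M g"
proof (rule power2_le_imp_le)
  have sq: "(\<integral>\<^sup>+x. (ennreal (cmod (h x)))\<^sup>2 \<partial>M) = ennreal ((L2_norm M h)\<^sup>2)" if "L2 M h" for h
    using that unfolding L2_norm_sq by (subst nn_integral_eq_integral[symmetric]) (auto simp: L2_def ennreal_power)
  have [measurable]: "f \<in> borel_measurable M" "g \<in> borel_measurable M" using assms by (auto simp: L2_def)
  have "(\<integral>\<^sup>+x. ennreal (cmod (f x)) * ennreal (cmod (g x)) \<partial>M)\<^sup>2 \<le> ennreal ((L2_norm M f)\<^sup>2) * ennreal ((L2_norm M g)\<^sup>2)"
    using Cauchy_Schwarz_nn_integral[of "\<lambda>x. ennreal (cmod (f x))" M "\<lambda>x. ennreal (cmod (g x))"] sq assms by simp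
  moreover have "(\<integral>\<^sup>+x. ennreal (cmod (f x)) * ennreal (cmod (g x)) \<partial>M) = ennreal (\<integral>x. cmod (f x) * cmod (g x) \<partial>M)"
    using nn_integral_eq_integral[OF L2_product_integrable[OF assms]] by (simp add: ennreal_mult)
  ultimately show "(\<integral>x. cmod (f x) * cmod (g x) \<partial>M)\<^sup>2 \<le> (L2_norm M f * L2_norm M g)\<^sup>2"
    by (simp add: ennreal_power ennreal_mult[symmetric] power_mult_distrib)
qed (simp add: L2_norm_nonneg)

lemma
  assumes "L2 M f" "L2 M g"
  shows L2_add: "L2 M (\<lambda>x. f x + g x)"
    and L2_norm_triangle: "L2_norm M (\<lambda>x. f x + g x) \<le> L2_norm M f + L2_norm M g"
proof -
  have [measurable]: "f \<in> borel_measurable M" "g \<in> borel_measurable M" using assms by (auto simp: L2_def)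
  define H where "H = (\<lambda>x. (cmod (f x))\<^sup>2 + 2 * (cmod (f x) * cmod (g x)) + (cmod (g x))\<^sup>2)"
  have H: "integrable M H"
    unfolding H_def using assms L2_product_integrable[OF assms] by (auto simp: L2_def)
  have le: "(cmod (f x + g x))\<^sup>2 \<le> H x" for x
  proof -
    have "(cmod (f x + g x))\<^sup>2 \<le> (cmod (f x) + cmod (g x))\<^sup>2"
      by (intro power_mono norm_triangle_ineq) auto
    then show ?thesis by (simp add: H_def power2_sum)
  qed
  have i: "integrable M (\<lambda>x. (cmod (f x + g x))\<^sup>2)"
    by (rule Bochner_Integration.integrable_bound[OF H]) (use le in \<open>auto simp: abs_of_nonneg intro: order_trans[OF _ abs_ge_self]\<close>)
  then show "L2 M (\<lambda>x. f x + g x)" by (simp add: L2_def)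
  show "L2_norm M (\<lambda>x. f x + g x) \<le> L2_norm M f + L2_norm M g"
  proof (rule power2_le_imp_le)
    have "(L2_norm M (\<lambda>x. f x + g x))\<^sup>2 \<le> (\<integral>x. H x \<partial>M)"
      unfolding L2_norm_sq by (intro integral_mono i H le)
    also have "\<dots> = (L2_norm M f)\<^sup>2 + 2 * (\<integral>x. cmod (f x) * cmod (g x) \<partial>M) + (L2_norm M g)\<^sup>2"
      unfolding H_def L2_norm_sq using assms L2_product_integrable[OF assms] by (simp add: L2_def)
    also have "\<dots> \<le> (L2_norm M f + L2_norm M g)\<^sup>2"
      using L2_Cauchy_Schwarz[OF assms] by (simp add: power2_sum)
    finally show "(L2_norm M (\<lambda>x. f x + g x))\<^sup>2 \<le> (L2_norm M f + L2_norm M g)\<^sup>2" .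
  qed (simp add: L2_norm_nonneg)
qed

lemma L2_uminus: "L2 M f \<Longrightarrow> L2 M (\<lambda>x. - f x)"
  by (simp add: L2_def)

lemma L2_norm_uminus: "L2_norm M (\<lambda>x. - f x) = L2_norm M f"
  by (simp add: L2_norm_def)

lemma L2_diff: "L2 M f \<Longrightarrow> L2 M g \<Longrightarrow> L2 M (\<lambda>x. f x - g x)"
  using L2_add[of M f "\<lambda>x. - g x"] L2_uminus[of M g] by simp

lemma L2_norm_triangle_diff: "L2 M f \<Longrightarrow> L2 M g \<Longrightarrow> L2_norm M (\<lambda>x. f x - g x) \<le> L2_norm M f + L2_norm M g"
  using L2_norm_triangle[of M f "\<lambda>x. - g x"] L2_uminus[of M g] L2_norm_uminus[of M g] by simp

lemma L2_scale: "L2 M f \<Longrightarrow> L2 M (\<lambda>x. c * f x)"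
  by (auto simp: L2_def norm_mult power_mult_distrib)

lemma L2_norm_scale: "L2_norm M (\<lambda>x. c * f x) = cmod c * L2_norm M f"
  by (simp add: L2_norm_def norm_mult power_mult_distrib real_sqrt_mult)

lemma L2_measurable: "L2 M f \<Longrightarrow> f \<in> borel_measurable M"
  by (simp add: L2_def)

lemma L2_norm_cong_AE: "f \<in> borel_measurable M \<Longrightarrow> g \<in> borel_measurable M \<Longrightarrow> AE x in M. f x = g x \<Longrightarrow> L2_norm M f = L2_norm M g"
  unfolding L2_norm_def by (intro arg_cong[where f=sqrt] integral_cong_AE) auto

lemma L2_norm_zero_AE: "L2 M f \<Longrightarrow> L2_norm M f = 0 \<Longrightarrow> AE x in M. f x = 0"
  unfolding L2_def L2_norm_def by (auto simp: integral_nonneg_eq_0_iff_AE)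

context unimodular_haar
begin

subsection \<open>Density and Young's inequality\<close>

lemma indicator_approx_Cc:
  assumes A: "A \<in> sets \<mu>" "emeasure \<mu> A < \<infinity>" and e: "e > 0"
  shows "\<exists>f :: 'g \<Rightarrow> real. Cc (\<lambda>x. complex_of_real (f x)) \<and> (\<integral>x. \<bar>indicator A x - f x\<bar> \<partial>\<mu>) < e"
proof -
  have "\<exists>U\<in>{U. open U \<and> A \<subseteq> U}. emeasure \<mu> U < emeasure \<mu> A + ennreal (e/2)"
    using A e by (intro INF_approx_ennreal[OF _ outer_regular]) (auto simp: sets_M)
  then obtain U where U: "open U" "A \<subseteq> U" "emeasure \<mu> U < emeasure \<mu> A + ennreal (e/2)" by blast
  then have Ufin: "emeasure \<mu> U < \<infinity>" using A(2) by (metis ennreal_add_eq_top ennreal_less_top infinity_ennreal_def less_top order_less_trans)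
  \<comment> \<open>\<open>K\<close> is sought inside \<open>U\<close> and not inside
    \<open>A\<close>, since inner regularity is given for open sets. The Urysohn function then
    differs from the indicator of \<open>A\<close> only on \<open>U - A\<close> and
    \<open>U - K\<close>.\<close>
  have "\<exists>K\<in>{K. compact K \<and> K \<subseteq> U}. emeasure \<mu> U < emeasure \<mu> K + ennreal (e/2)"
    using e Ufin by (intro SUP_approx_ennreal[OF _ _ inner_regular[OF U(1)]]) auto
  then obtain K where K: "compact K" "K \<subseteq> U" "emeasure \<mu> U < emeasure \<mu> K + ennreal (e/2)" by blast
  obtain f :: "'g \<Rightarrow> real" where f: "Cc (\<lambda>x. complex_of_real (f x))" "\<And>x. 0 \<le> f x" "\<And>x. f x \<le> 1"
      "\<And>x. x \<notin> U \<Longrightarrow> f x = 0" "\<And>x. x \<in> K \<Longrightarrow> f x = 1" "integrable \<mu> f"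
    using Urysohn_integral[OF K(1) U(1) K(2)] by blast
  have fm: "A \<in> fmeasurable \<mu>" "U \<in> fmeasurable \<mu>" "K \<in> fmeasurable \<mu>"
    using A Ufin open_sets[OF U(1)] compact_sets[OF K(1)] compact_finite[OF K(1)] by (auto simp: fmeasurable_def)
  have fd: "emeasure \<mu> (U - A) < \<infinity>" "emeasure \<mu> (U - K) < \<infinity>" "U - A \<in> sets \<mu>" "U - K \<in> sets \<mu>"
    using fmeasurable_Diff[OF fm(2), of A] fmeasurable_Diff[OF fm(2), of K] fm by (auto simp: fmeasurable_def)
  have real: "measure \<mu> U < measure \<mu> B + e/2" if "B \<in> fmeasurable \<mu>" "emeasure \<mu> U < emeasure \<mu> B + ennreal (e/2)" for B
    using that fm e by (simp add: emeasure_eq_measure2 ennreal_plus[symmetric] ennreal_less_iff del: ennreal_plus)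
  have "(\<integral>x. \<bar>indicator A x - f x\<bar> \<partial>\<mu>) \<le> (\<integral>x. indicator (U - A) x + indicator (U - K) x \<partial>\<mu>)"
  proof (rule integral_mono)
    show "integrable \<mu> (\<lambda>x. \<bar>indicator A x - f x\<bar>)"
      using f(6) A by (intro integrable_abs Bochner_Integration.integrable_diff) auto
    show "integrable \<mu> (\<lambda>x. indicator (U - A) x + indicator (U - K) x :: real)"
      using fd by (intro Bochner_Integration.integrable_add integrable_real_indicator)
    fix x
    show "\<bar>indicator A x - f x\<bar> \<le> indicator (U - A) x + indicator (U - K) x"
      using f(2)[of x] f(3)[of x] f(4)[of x] f(5)[of x] U(2) K(2) by (auto simp: indicator_def)
  qed
  also have "\<dots> = measure \<mu> (U - A) + measure \<mu> (U - K)"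
    using fd by (subst Bochner_Integration.integral_add) (auto intro!: integrable_real_indicator simp: space_M)
  also have "\<dots> = (measure \<mu> U - measure \<mu> A) + (measure \<mu> U - measure \<mu> K)"
    using fm U K by (simp add: measurable_measure_Diff fmeasurableD)
  also have "\<dots> < e" using real[of A] real[of K] fm U K by linarith
  finally show ?thesis using f(1) by blast
qed

lemma L1_dense:
  fixes f :: "'g \<Rightarrow> complex"
  assumes "integrable \<mu> f" "e > 0"
  shows "\<exists>g. Cc g \<and> (\<integral>x. cmod (f x - g x) \<partial>\<mu>) < e"
  using assms
proof (induction arbitrary: e rule: integrable_induct)
  case (base A c)
  have "e / (cmod c + 1) > 0" using base(3) by (simp add: add_nonneg_pos)
  then obtain h :: "'g \<Rightarrow> real" where h: "Cc (\<lambda>x. complex_of_real (h x))" "(\<integral>x. \<bar>indicator A x - h x\<bar> \<partial>\<mu>) < e / (cmod c + 1)"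
    using indicator_approx_Cc[OF base(1,2)] by blast
  have "cmod (indicator A x *\<^sub>R c - c * complex_of_real (h x)) = cmod c * \<bar>indicator A x - h x\<bar>" for x
  proof -
    have "indicator A x *\<^sub>R c - c * complex_of_real (h x) = c * complex_of_real (indicator A x - h x)"
      by (simp add: algebra_simps scaleR_conv_of_real)
    then show ?thesis by (simp only: norm_mult norm_of_real)
  qed
  then have "(\<integral>x. cmod (indicator A x *\<^sub>R c - c * complex_of_real (h x)) \<partial>\<mu>) = cmod c * (\<integral>x. \<bar>indicator A x - h x\<bar> \<partial>\<mu>)"
    by simp
  also have "\<dots> \<le> cmod c * (e / (cmod c + 1))"
    using h(2) by (intro mult_left_mono) auto
  also have "\<dots> < e" using base(3) by (simp add: field_simps add_pos_nonneg)
  finally show ?case using Cc_scale[OF h(1), of c] by blast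
next
  case (add f g)
  obtain f' where f': "Cc f'" "(\<integral>x. cmod (f x - f' x) \<partial>\<mu>) < e/2" using add(3)[of "e/2"] add(5) by auto
  obtain g' where g': "Cc g'" "(\<integral>x. cmod (g x - g' x) \<partial>\<mu>) < e/2" using add(4)[of "e/2"] add(5) by auto
  note i = add(1,2) Cc_integrable[OF f'(1)] Cc_integrable[OF g'(1)]
  have "(\<integral>x. cmod (f x + g x - (f' x + g' x)) \<partial>\<mu>) \<le> (\<integral>x. cmod (f x - f' x) + cmod (g x - g' x) \<partial>\<mu>)"
  proof (rule integral_mono)
    fix x
    show "cmod (f x + g x - (f' x + g' x)) \<le> cmod (f x - f' x) + cmod (g x - g' x)"
      using norm_triangle_ineq[of "f x - f' x" "g x - g' x"] by (simp add: algebra_simps)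
  qed (use i in auto)
  also have "\<dots> < e" using f'(2) g'(2) i by (subst Bochner_Integration.integral_add) auto
  finally show ?case using Cc_add[OF f'(1) g'(1)] by blast
next
  case (lim f s)
  have [measurable]: "f \<in> borel_measurable \<mu>" "\<And>i. s i \<in> borel_measurable \<mu>" using lim by auto
  have "(\<lambda>i. \<integral>x. cmod (f x - s i x) \<partial>\<mu>) \<longlonglongrightarrow> (\<integral>x. 0 \<partial>\<mu>)"
  \<comment> \<open>The induction rule bounds \<open>s i\<close> by twice \<open>f\<close> in
    modulus, hence the factor 3.\<close>
  proof (rule integral_dominated_convergence[where w="\<lambda>x. 3 * cmod (f x)"])
    show "integrable \<mu> (\<lambda>x. 3 * cmod (f x))" using lim.hyps(4) by simp
    show "AE x in \<mu>. (\<lambda>i. cmod (f x - s i x)) \<longlonglongrightarrow> 0"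
    proof (rule AE_I2)
      fix x assume "x \<in> space \<mu>"
      then have "(\<lambda>i. cmod (f x - s i x)) \<longlonglongrightarrow> cmod (f x - f x)"
        by (intro tendsto_intros lim.hyps(2))
      then show "(\<lambda>i. cmod (f x - s i x)) \<longlonglongrightarrow> 0" by simp
    qed
    show "AE x in \<mu>. norm (cmod (f x - s i x)) \<le> 3 * cmod (f x)" for i
    proof (rule AE_I2)
      fix x assume "x \<in> space \<mu>"
      then show "norm (cmod (f x - s i x)) \<le> 3 * cmod (f x)"
        using lim.hyps(3)[of x i] norm_triangle_ineq4[of "f x" "s i x"] by simp
    qed
  qed auto
  then have "\<forall>\<^sub>F i in sequentially. (\<integral>x. cmod (f x - s i x) \<partial>\<mu>) < e/2"
    using lim.prems by (intro order_tendstoD(2)[where y=0]) auto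
  then obtain i where i: "(\<integral>x. cmod (f x - s i x) \<partial>\<mu>) < e/2"
    using eventually_happens'[OF sequentially_bot] by blast
  obtain g where g: "Cc g" "(\<integral>x. cmod (s i x - g x) \<partial>\<mu>) < e/2" using lim.IH[of "e/2" i] lim.prems by auto
  note int = lim.hyps(1)[of i] lim.hyps(4) Cc_integrable[OF g(1)]
  have "(\<integral>x. cmod (f x - g x) \<partial>\<mu>) \<le> (\<integral>x. cmod (f x - s i x) + cmod (s i x - g x) \<partial>\<mu>)"
  proof (rule integral_mono)
    fix x
    show "cmod (f x - g x) \<le> cmod (f x - s i x) + cmod (s i x - g x)"
      using norm_triangle_ineq[of "f x - s i x" "s i x - g x"] by simp
  qed (use int in auto)
  also have "\<dots> < e" using i g(2) int by (subst Bochner_Integration.integral_add) auto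
  finally show ?case using g(1) by blast
qed

text \<open>Shaped for Fatou's lemma: pointwise convergence controls the integrand, convergence of
  the norms controls the bound in the limit.\<close>

lemma L1_approx_sequence:
  fixes f :: "'g \<Rightarrow> complex"
  assumes f: "integrable \<mu> f"
  obtains g where "\<And>n::nat. Cc (g n)" "AE x in \<mu>. (\<lambda>n. g n x) \<longlonglongrightarrow> f x"
    "(\<lambda>n. \<integral>x. cmod (g n x) \<partial>\<mu>) \<longlonglongrightarrow> (\<integral>x. cmod (f x) \<partial>\<mu>)"
proof -
  have "\<exists>g. Cc g \<and> (\<integral>x. cmod (f x - g x) \<partial>\<mu>) < inverse (real (Suc n))" for n
    using L1_dense[OF f] by simp
  then obtain g where g: "\<And>n. Cc (g n)" "\<And>n. (\<integral>x. cmod (f x - g n x) \<partial>\<mu>) < inverse (real (Suc n))"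
    by metis
  note gi = Cc_integrable[OF g(1)]
  have lim0: "(\<lambda>n. \<integral>x. cmod (f x - g n x) \<partial>\<mu>) \<longlonglongrightarrow> 0"
    by (rule tendsto_sandwich[OF _ _ tendsto_const LIMSEQ_inverse_real_of_nat])
      (use less_imp_le[OF g(2)] in \<open>simp_all\<close>)
  then obtain r :: "nat \<Rightarrow> nat" where r: "strict_mono r" "AE x in \<mu>. (\<lambda>n. f x - g (r n) x) \<longlonglongrightarrow> 0"
    using tendsto_L1_AE_subseq[of \<mu> "\<lambda>n x. f x - g n x"] f gi by auto
  have "\<bar>(\<integral>x. cmod (g n x) \<partial>\<mu>) - (\<integral>x. cmod (f x) \<partial>\<mu>)\<bar> \<le> (\<integral>x. cmod (f x - g n x) \<partial>\<mu>)" for n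
  proof -
    have "\<bar>\<integral>x. cmod (g n x) - cmod (f x) \<partial>\<mu>\<bar> \<le> (\<integral>x. \<bar>cmod (g n x) - cmod (f x)\<bar> \<partial>\<mu>)"
      by (rule integral_abs_bound)
    also have "\<dots> \<le> (\<integral>x. cmod (f x - g n x) \<partial>\<mu>)"
      using f gi[of n] norm_triangle_ineq3 by (intro integral_mono) (auto simp: norm_minus_commute[of "f _"])
    finally show ?thesis using f gi[of n] by simp
  qed
  then have "(\<lambda>n. (\<integral>x. cmod (g n x) \<partial>\<mu>) - (\<integral>x. cmod (f x) \<partial>\<mu>)) \<longlonglongrightarrow> 0"
    by (intro tendsto_norm_zero_cancel[OF tendsto_sandwich[OF _ _ tendsto_const lim0]]) auto
  then have l: "(\<lambda>n. \<integral>x. cmod (g n x) \<partial>\<mu>) \<longlonglongrightarrow> (\<integral>x. cmod (f x) \<partial>\<mu>)"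
    by (simp add: LIM_zero_iff)
  show ?thesis
  proof (rule that[of "\<lambda>n. g (r n)"])
    show "(\<lambda>n. \<integral>x. cmod (g (r n) x) \<partial>\<mu>) \<longlonglongrightarrow> (\<integral>x. cmod (f x) \<partial>\<mu>)"
      using LIMSEQ_subseq_LIMSEQ[OF l r(1)] by (simp add: o_def)
    show "AE x in \<mu>. (\<lambda>n. g (r n) x) \<longlonglongrightarrow> f x"
      using r(2)
    proof eventually_elim
      fix x assume "(\<lambda>n. f x - g (r n) x) \<longlonglongrightarrow> 0"
      from tendsto_diff[OF tendsto_const[of "f x"] this] show "(\<lambda>n. g (r n) x) \<longlonglongrightarrow> f x" by simp
    qed
  qed (rule g(1))
qed

section \<open>Young's inequality for \<open>L\<^sup>1\<close> acting on \<open>L\<^sup>2\<close> by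
  convolution\<close>

lemma reflection_AE:
  assumes "AE y in \<mu>. P y" shows "AE y in \<mu>. P (- y + x)"
  using measure_preserving_AE[OF inversion measure_preserving_AE[OF right_translation[of x] assms]] .

lemma reflection_measurable:
  assumes "f \<in> borel_measurable \<mu>" shows "(\<lambda>y. f (- y + x)) \<in> borel_measurable \<mu>"
  using measurable_compose[OF measurable_compose[OF inversion(1) right_translation(1)[of x]] assms] .

text \<open>The convolution of two Borel functions need not be visibly Borel measurable, hence the
  measurable majorant \<open>\<Phi>\<close>; it comes from Fatou's lemma along approximations in \<open>C\<^sub>c\<close>.\<close>

lemma L1_conv_majorant:
  fixes u v :: "'g \<Rightarrow> complex"
  assumes u: "integrable \<mu> u" and v: "integrable \<mu> v"
  obtains \<Phi> :: "'g \<Rightarrow> ennreal" where "\<Phi> \<in> borel_measurable \<mu>"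
    "\<And>x. (\<integral>\<^sup>+y. ennreal (cmod (u y) * cmod (v (- y + x))) \<partial>\<mu>) \<le> \<Phi> x"
    "(\<integral>\<^sup>+x. \<Phi> x \<partial>\<mu>) \<le> ennreal ((\<integral>x. cmod (u x) \<partial>\<mu>) * (\<integral>x. cmod (v x) \<partial>\<mu>))"
proof -
  obtain a where a: "\<And>n::nat. Cc (a n)" "AE x in \<mu>. (\<lambda>n. a n x) \<longlonglongrightarrow> u x"
    "(\<lambda>n. \<integral>x. cmod (a n x) \<partial>\<mu>) \<longlonglongrightarrow> (\<integral>x. cmod (u x) \<partial>\<mu>)"
    using L1_approx_sequence[OF u] by blast
  obtain b where b: "\<And>n::nat. Cc (b n)" "AE x in \<mu>. (\<lambda>n. b n x) \<longlonglongrightarrow> v x"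
    "(\<lambda>n. \<integral>x. cmod (b n x) \<partial>\<mu>) \<longlonglongrightarrow> (\<integral>x. cmod (v x) \<partial>\<mu>)"
    using L1_approx_sequence[OF v] by blast
  \<comment> \<open>The moduli again lie in \<open>Cc\<close>, so their convolution
    \<open>w n\<close> is continuous, hence Borel, and its total mass is the product of the two
    \<open>L\<^sup>1\<close> norms.\<close>
  define a' where "a' = (\<lambda>n x. complex_of_real (cmod (a n x)))"
  define b' where "b' = (\<lambda>n x. complex_of_real (cmod (b n x)))"
  have a': "Cc (a' n)" for n
    unfolding a'_def by (rule Cc_image[OF a(1), where h="\<lambda>x. complex_of_real (cmod x)"]) (auto intro!: continuous_intros)
  have b': "Cc (b' n)" for n
    unfolding b'_def by (rule Cc_image[OF b(1), where h="\<lambda>x. complex_of_real (cmod x)"]) (auto intro!: continuous_intros)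
  define w where "w = (\<lambda>n x. \<integral>y. cmod (a n y) * cmod (b n (- y + x)) \<partial>\<mu>)"
  have w_conv: "(a' n \<star> b' n) x = complex_of_real (w n x)" for n x
    by (simp add: left_reg_def a'_def b'_def w_def flip: of_real_mult)
  have w_int: "integrable \<mu> (\<lambda>y. cmod (a n y) * cmod (b n (- y + x)))" for n x
    using integrable_Re[OF conv_integrable[OF a'[of n] b'[of n], of x]] by (simp add: a'_def b'_def flip: of_real_mult)
  have w0: "w n x \<ge> 0" for n x by (simp add: w_def)
  have w_re: "w n = (\<lambda>x. Re ((a' n \<star> b' n) x))" for n by (simp add: w_conv)
  have wi: "integrable \<mu> (w n)" for n
    unfolding w_re by (intro integrable_Re Cc_integrable Cc_conv a' b')
  have wm[measurable]: "w n \<in> borel_measurable \<mu>" for n using wi by auto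
  have w_total: "(\<integral>x. w n x \<partial>\<mu>) = (\<integral>x. cmod (a n x) \<partial>\<mu>) * (\<integral>x. cmod (b n x) \<partial>\<mu>)" for n
  proof -
    have "complex_of_real (\<integral>x. w n x \<partial>\<mu>) = complex_of_real ((\<integral>x. cmod (a n x) \<partial>\<mu>) * (\<integral>x. cmod (b n x) \<partial>\<mu>))"
      using integral_conv[OF a'[of n] b'[of n]] unfolding w_conv unfolding a'_def b'_def by simp
    then show ?thesis unfolding of_real_eq_iff .
  qed
  define \<Phi> where "\<Phi> = (\<lambda>x. liminf (\<lambda>n. ennreal (w n x)))"
  show ?thesis
  proof (rule that[of \<Phi>])
    show "\<Phi> \<in> borel_measurable \<mu>" unfolding \<Phi>_def by measurable
    fix x
    note ab = a(2) reflection_AE[OF b(2), of x]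
    have "(\<integral>\<^sup>+y. ennreal (cmod (u y) * cmod (v (- y + x))) \<partial>\<mu>)
        = (\<integral>\<^sup>+y. liminf (\<lambda>n. ennreal (cmod (a n y) * cmod (b n (- y + x)))) \<partial>\<mu>)"
    proof (rule nn_integral_cong_AE)
      show "AE y in \<mu>. ennreal (cmod (u y) * cmod (v (- y + x))) = liminf (\<lambda>n. ennreal (cmod (a n y) * cmod (b n (- y + x))))"
        using ab
      proof eventually_elim
        case (elim y)
        then have "(\<lambda>n. ennreal (cmod (a n y) * cmod (b n (- y + x)))) \<longlonglongrightarrow> ennreal (cmod (u y) * cmod (v (- y + x)))"
          by (intro tendsto_intros)
        from lim_imp_Liminf[OF trivial_limit_sequentially this] show ?case by simp
      qed
    qed
    also have "\<dots> \<le> liminf (\<lambda>n. \<integral>\<^sup>+y. ennreal (cmod (a n y) * cmod (b n (- y + x))) \<partial>\<mu>)"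
      using w_int by (intro nn_integral_liminf) auto
    also have "\<dots> = \<Phi> x"
      unfolding \<Phi>_def w_def using w_int by (subst nn_integral_eq_integral) auto
    finally show "(\<integral>\<^sup>+y. ennreal (cmod (u y) * cmod (v (- y + x))) \<partial>\<mu>) \<le> \<Phi> x" .
  next
    have "(\<integral>\<^sup>+x. \<Phi> x \<partial>\<mu>) \<le> liminf (\<lambda>n. \<integral>\<^sup>+x. ennreal (w n x) \<partial>\<mu>)"
      unfolding \<Phi>_def by (intro nn_integral_liminf) auto
    also have "\<dots> = liminf (\<lambda>n. ennreal ((\<integral>x. cmod (a n x) \<partial>\<mu>) * (\<integral>x. cmod (b n x) \<partial>\<mu>)))"
      using wi w0 by (subst nn_integral_eq_integral) (auto simp: w_total)
    also have "\<dots> = ennreal ((\<integral>x. cmod (u x) \<partial>\<mu>) * (\<integral>x. cmod (v x) \<partial>\<mu>))"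
      by (intro lim_imp_Liminf tendsto_intros a(3) b(3)) auto
    finally show "(\<integral>\<^sup>+x. \<Phi> x \<partial>\<mu>) \<le> ennreal ((\<integral>x. cmod (u x) \<partial>\<mu>) * (\<integral>x. cmod (v x) \<partial>\<mu>))" .
  qed
qed

text \<open>Splitting the modulus of \<open>f\<close> into two square roots, Cauchy-Schwarz bounds
  the squared modulus of the convolution by \<open>F\<close> times the convolution of the moduli of
  \<open>f\<close> and \<open>v\<close>, where \<open>v\<close> is the squared modulus of
  \<open>\<xi>\<close>; the majorant \<open>\<Phi>\<close> controls the latter. The norm bound takes
  measurability as a premise because the convolution is only compared with
  \<open>\<Phi>\<close>.\<close>

lemma
  fixes f \<xi> :: "'g \<Rightarrow> complex"
  assumes f: "integrable \<mu> f" and \<xi>: "L2 \<mu> \<xi>"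
  shows Young_integrable: "AE x in \<mu>. integrable \<mu> (\<lambda>y. f y * \<xi> (- y + x))"
    and Young_norm: "f \<star> \<xi> \<in> borel_measurable \<mu> \<Longrightarrow> L2_norm \<mu> (f \<star> \<xi>) \<le> (\<integral>x. cmod (f x) \<partial>\<mu>) * L2_norm \<mu> \<xi>"
proof -
  define v where "v = (\<lambda>x. complex_of_real ((cmod (\<xi> x))\<^sup>2))"
  define F where "F = (\<integral>x. cmod (f x) \<partial>\<mu>)"
  have F0: "F \<ge> 0" by (simp add: F_def)
  have v: "integrable \<mu> v" "cmod (v x) = (cmod (\<xi> x))\<^sup>2" for x
    unfolding v_def using \<xi> by (auto simp: L2_def norm_power simp del: of_real_power intro!: integrable_of_real)
  have fm: "f \<in> borel_measurable \<mu>" and \<xi>m: "\<xi> \<in> borel_measurable \<mu>"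
    using f \<xi> by (auto simp: L2_def)
  note fm[measurable] reflection_measurable[OF \<xi>m, measurable]
  obtain \<Phi> :: "'g \<Rightarrow> ennreal" where \<Phi>[measurable]: "\<Phi> \<in> borel_measurable \<mu>"
    and \<Phi>_ge: "\<And>x. (\<integral>\<^sup>+y. ennreal (cmod (f y) * cmod (v (- y + x))) \<partial>\<mu>) \<le> \<Phi> x"
    and \<Phi>_int: "(\<integral>\<^sup>+x. \<Phi> x \<partial>\<mu>) \<le> ennreal (F * (\<integral>x. cmod (v x) \<partial>\<mu>))"
    unfolding F_def using L1_conv_majorant[OF f v(1)] by blast
  have bound: "(\<integral>\<^sup>+y. ennreal (cmod (f y * \<xi> (- y + x))) \<partial>\<mu>)\<^sup>2 \<le> ennreal F * \<Phi> x" for x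
  proof -
    have "(\<integral>\<^sup>+y. ennreal (cmod (f y * \<xi> (- y + x))) \<partial>\<mu>) =
       (\<integral>\<^sup>+y. ennreal (sqrt (cmod (f y))) * ennreal (sqrt (cmod (f y)) * cmod (\<xi> (- y + x))) \<partial>\<mu>)"
      by (intro nn_integral_cong) (simp add: norm_mult mult.assoc[symmetric] flip: ennreal_mult)
    also have "\<dots>\<^sup>2 \<le> (\<integral>\<^sup>+y. (ennreal (sqrt (cmod (f y))))\<^sup>2 \<partial>\<mu>) * (\<integral>\<^sup>+y. (ennreal (sqrt (cmod (f y)) * cmod (\<xi> (- y + x))))\<^sup>2 \<partial>\<mu>)"
      by (rule Cauchy_Schwarz_nn_integral) measurable
    also have "(\<integral>\<^sup>+y. (ennreal (sqrt (cmod (f y))))\<^sup>2 \<partial>\<mu>) = ennreal F"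
      unfolding F_def using f by (simp add: ennreal_power nn_integral_eq_integral)
    also have "(\<integral>\<^sup>+y. (ennreal (sqrt (cmod (f y)) * cmod (\<xi> (- y + x))))\<^sup>2 \<partial>\<mu>) \<le> \<Phi> x"
      using \<Phi>_ge[of x] by (simp add: ennreal_power power_mult_distrib v(2))
    finally show ?thesis by (simp add: mult_left_mono)
  qed
  have "(\<integral>\<^sup>+x. \<Phi> x \<partial>\<mu>) \<noteq> \<infinity>" using \<Phi>_int by (auto simp: top_unique)
  then have "AE x in \<mu>. \<Phi> x \<noteq> \<infinity>" by (intro nn_integral_PInf_AE \<Phi>)
  then show "AE x in \<mu>. integrable \<mu> (\<lambda>y. f y * \<xi> (- y + x))"
  proof eventually_elim
    case (elim x)
    then have "ennreal F * \<Phi> x < \<infinity>" by (simp add: ennreal_mult_less_top less_top)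
    then have "(\<integral>\<^sup>+y. ennreal (cmod (f y * \<xi> (- y + x))) \<partial>\<mu>)\<^sup>2 < \<infinity>"
      using bound[of x] by (rule le_less_trans[rotated])
    then have "(\<integral>\<^sup>+y. ennreal (cmod (f y * \<xi> (- y + x))) \<partial>\<mu>) < \<infinity>"
      by (simp add: power_less_top_ennreal)
    then show ?case by (intro integrableI_bounded) auto
  qed
  assume m[measurable]: "f \<star> \<xi> \<in> borel_measurable \<mu>"
  have pt: "ennreal ((cmod ((f \<star> \<xi>) x))\<^sup>2) \<le> ennreal F * \<Phi> x" for x
  proof (cases "integrable \<mu> (\<lambda>y. f y * \<xi> (- y + x))")
    case True
    have "ennreal ((cmod ((f \<star> \<xi>) x))\<^sup>2) = (ennreal (cmod ((f \<star> \<xi>) x)))\<^sup>2"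
      by (simp add: ennreal_power)
    also have "\<dots> \<le> (\<integral>\<^sup>+y. ennreal (cmod (f y * \<xi> (- y + x))) \<partial>\<mu>)\<^sup>2"
      unfolding left_reg_def by (intro power_mono integral_norm_bound_ennreal True) simp
    finally show ?thesis using bound[of x] by simp
  \<comment> \<open>Where the integral fails to exist \<open>left_reg\<close> has the default value
    0, so the bound is trivial there.\<close>
  qed (simp add: left_reg_def not_integrable_integral_eq)
  have "(\<integral>\<^sup>+x. ennreal ((cmod ((f \<star> \<xi>) x))\<^sup>2) \<partial>\<mu>) \<le> (\<integral>\<^sup>+x. ennreal F * \<Phi> x \<partial>\<mu>)"
    by (intro nn_integral_mono pt)
  also have "\<dots> = ennreal F * (\<integral>\<^sup>+x. \<Phi> x \<partial>\<mu>)" by (rule nn_integral_cmult) simp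
  also have "\<dots> \<le> ennreal F * ennreal (F * (\<integral>x. cmod (v x) \<partial>\<mu>))"
    by (intro mult_left_mono \<Phi>_int) simp
  also have "\<dots> = ennreal ((F * L2_norm \<mu> \<xi>)\<^sup>2)"
    using F0 by (simp add: v(2) power_mult_distrib L2_norm_sq mult.assoc power2_eq_square[of F] flip: ennreal_mult)
  finally have fin: "(\<integral>\<^sup>+x. ennreal ((cmod ((f \<star> \<xi>) x))\<^sup>2) \<partial>\<mu>) \<le> ennreal ((F * L2_norm \<mu> \<xi>)\<^sup>2)" .
  have i: "integrable \<mu> (\<lambda>x. (cmod ((f \<star> \<xi>) x))\<^sup>2)"
    using fin by (intro integrableI_bounded) (auto simp: le_less_trans)
  have "(L2_norm \<mu> (f \<star> \<xi>))\<^sup>2 \<le> (F * L2_norm \<mu> \<xi>)\<^sup>2"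
    using fin i by (simp add: nn_integral_eq_integral L2_norm_sq)
  then show "L2_norm \<mu> (f \<star> \<xi>) \<le> (\<integral>x. cmod (f x) \<partial>\<mu>) * L2_norm \<mu> \<xi>"
    unfolding F_def[symmetric] using F0 L2_norm_nonneg by (intro power2_le_imp_le[of "L2_norm \<mu> (f \<star> \<xi>)"] mult_nonneg_nonneg) auto
qed

section \<open>Density of \<open>Cc\<close> in \<open>L\<^sup>2\<close>\<close>

lemma Cc_L2: assumes "Cc f" shows "L2 \<mu> f"
proof -
  have "Cc (\<lambda>x. complex_of_real ((cmod (f x))\<^sup>2))"
    by (rule Cc_image[OF assms, where h="\<lambda>z. complex_of_real ((cmod z)\<^sup>2)"]) (auto intro!: continuous_intros)
  from integrable_Re[OF Cc_integrable[OF this]] show ?thesis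
    using Cc_measurable[OF assms] by (simp add: L2_def)
qed

text \<open>Reduced to density in \<open>L\<^sup>1\<close>: for functions bounded by a common
  constant, closeness in \<open>L\<^sup>1\<close> implies closeness in
  \<open>L\<^sup>2\<close>.\<close>

lemma L2_dense:
  assumes \<xi>: "L2 \<mu> \<xi>" and e: "e > 0"
  shows "\<exists>g. Cc g \<and> L2_norm \<mu> (\<lambda>x. \<xi> x - g x) < e"
proof -
  have \<xi>m[measurable]: "\<xi> \<in> borel_measurable \<mu>" and \<xi>i: "integrable \<mu> (\<lambda>x. (cmod (\<xi> x))\<^sup>2)"
    using \<xi> by (auto simp: L2_def)
  \<comment> \<open>The lower cutoff gives integrability, since there the modulus of
    \<open>\<xi>\<close> is at most \<open>n\<close> times its square; the upper cutoff gives
    boundedness.\<close>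
  define h where "h = (\<lambda>(n::nat) x. if 1 \<le> real n * cmod (\<xi> x) \<and> cmod (\<xi> x) \<le> real n then \<xi> x else 0)"
  have hm[measurable]: "h n \<in> borel_measurable \<mu>" for n unfolding h_def by measurable
  have hb: "cmod (h n x) \<le> real n" for n x by (simp add: h_def)
  have hi: "integrable \<mu> (h n)" for n
  proof (rule Bochner_Integration.integrable_bound)
    show "integrable \<mu> (\<lambda>x. real n * (cmod (\<xi> x))\<^sup>2)" using \<xi>i by simp
    show "AE x in \<mu>. norm (h n x) \<le> norm (real n * (cmod (\<xi> x))\<^sup>2)"
    proof (rule AE_I2)
      fix x
      have "cmod (\<xi> x) \<le> real n * (cmod (\<xi> x))\<^sup>2" if "1 \<le> real n * cmod (\<xi> x)"
        using mult_right_mono[OF that, of "cmod (\<xi> x)"] by (simp add: power2_eq_square mult.assoc)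
      then show "norm (h n x) \<le> norm (real n * (cmod (\<xi> x))\<^sup>2)"
        by (auto simp: h_def)
    qed
  qed simp
  have "(\<lambda>n. \<integral>x. (cmod (\<xi> x - h n x))\<^sup>2 \<partial>\<mu>) \<longlonglongrightarrow> (\<integral>x. 0 \<partial>\<mu>)"
  proof (rule integral_dominated_convergence[where w="\<lambda>x. (cmod (\<xi> x))\<^sup>2"])
    show "AE x in \<mu>. (\<lambda>n. (cmod (\<xi> x - h n x))\<^sup>2) \<longlonglongrightarrow> 0"
    proof (rule AE_I2)
      fix x
      have "\<forall>\<^sub>F n in sequentially. \<xi> x = h n x"
      proof (cases "\<xi> x = 0")
        case False
        have "\<forall>\<^sub>F n in sequentially. max (1 / cmod (\<xi> x)) (cmod (\<xi> x)) \<le> real n"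
          using filterlim_real_sequentially unfolding filterlim_at_top by blast
        then show ?thesis
          by eventually_elim (use False in \<open>auto simp: h_def field_simps\<close>)
      qed (simp add: h_def)
      then show "(\<lambda>n. (cmod (\<xi> x - h n x))\<^sup>2) \<longlonglongrightarrow> 0"
        by (intro tendsto_eventually) (auto elim: eventually_mono)
    qed
    show "AE x in \<mu>. norm ((cmod (\<xi> x - h n x))\<^sup>2) \<le> (cmod (\<xi> x))\<^sup>2" for n
      by (simp add: h_def)
  qed (use \<xi>i in auto)
  then have "\<forall>\<^sub>F n in sequentially. (\<integral>x. (cmod (\<xi> x - h n x))\<^sup>2 \<partial>\<mu>) < (e/2)\<^sup>2"
    using e by (intro order_tendstoD(2)[where y=0]) auto
  then obtain n where n: "(\<integral>x. (cmod (\<xi> x - h n x))\<^sup>2 \<partial>\<mu>) < (e/2)\<^sup>2"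
    using eventually_happens'[OF sequentially_bot] by blast
  have hL2: "L2 \<mu> (h n)"
  proof -
    have "integrable \<mu> (\<lambda>x. (cmod (h n x))\<^sup>2)"
      by (rule Bochner_Integration.integrable_bound[OF \<xi>i]) (auto simp: h_def)
    then show ?thesis by (simp add: L2_def)
  qed
  have a: "L2_norm \<mu> (\<lambda>x. \<xi> x - h n x) < e/2"
  proof -
    have "L2_norm \<mu> (\<lambda>x. \<xi> x - h n x) < sqrt ((e/2)\<^sup>2)"
      unfolding L2_norm_def by (rule real_sqrt_less_mono[OF n])
    then show ?thesis using e by simp
  qed
  define N where "N = real n"
  have N0: "N \<ge> 0" by (simp add: N_def)
  \<comment> \<open>Chosen so that \<open>3 * N * d\<close> stays below
    \<open>(e/2)\<^sup>2\<close>, also when \<open>N = 0\<close>.\<close>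
  define d where "d = (e/2)\<^sup>2 / (3 * N + 1)"
  have d: "d > 0" unfolding d_def using e N0 by (intro divide_pos_pos) auto
  obtain g0 where g0: "Cc g0" "(\<integral>x. cmod (h n x - g0 x) \<partial>\<mu>) < d" using L1_dense[OF hi d] by blast
  \<comment> \<open>Clipping real and imaginary parts to the range of those of \<open>h n\<close>
    brings \<open>g0\<close> no farther from \<open>h n\<close>, bounds it by \<open>2 * N\<close>,
    and stays in \<open>Cc\<close> because 0 is fixed.\<close>
  define clip where "clip = (\<lambda>t. max (- N) (min N t))"
  define c where "c = (\<lambda>z. complex_of_real (clip (Re z)) + \<i> * complex_of_real (clip (Im z)))"
  have cc: "continuous_on UNIV c" unfolding c_def clip_def by (intro continuous_intros)
  have c0: "c 0 = 0" using N0 by (simp add: c_def clip_def)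
  define g where "g = (\<lambda>x. c (g0 x))"
  have g: "Cc g" unfolding g_def by (rule Cc_image[OF g0(1) cc c0])
  have clip: "\<bar>s - clip t\<bar> \<le> \<bar>s - t\<bar>" "\<bar>clip t\<bar> \<le> N" if "\<bar>s\<bar> \<le> N" for s t
    using that N0 by (auto simp: clip_def max_def min_def)
  have le1: "cmod (h n x - g x) \<le> cmod (h n x - g0 x)" for x
  proof -
    have "\<bar>Re (h n x) - clip (Re (g0 x))\<bar> \<le> \<bar>Re (h n x) - Re (g0 x)\<bar>"
      "\<bar>Im (h n x) - clip (Im (g0 x))\<bar> \<le> \<bar>Im (h n x) - Im (g0 x)\<bar>"
      using clip hb[of n x] abs_Re_le_cmod[of "h n x"] abs_Im_le_cmod[of "h n x"] by (auto simp: N_def)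
    then show ?thesis
      unfolding cmod_def by (intro real_sqrt_le_mono add_mono) (simp_all add: g_def c_def abs_le_square_iff)
  qed
  have le2: "cmod (h n x - g x) \<le> 3 * N" for x
  proof -
    have "cmod (g x) \<le> \<bar>Re (g x)\<bar> + \<bar>Im (g x)\<bar>" by (rule cmod_le)
    also have "\<dots> \<le> N + N" using clip(2)[of 0] N0 by (intro add_mono) (auto simp: g_def c_def)
    finally show ?thesis using norm_triangle_ineq4[of "h n x" "g x"] hb[of n x] by (simp add: N_def)
  qed
  have b: "L2_norm \<mu> (\<lambda>x. h n x - g x) < e/2"
  proof -
    have "(\<integral>x. (cmod (h n x - g x))\<^sup>2 \<partial>\<mu>) \<le> (\<integral>x. 3 * N * cmod (h n x - g0 x) \<partial>\<mu>)"
    proof (rule integral_mono)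
      show "integrable \<mu> (\<lambda>x. (cmod (h n x - g x))\<^sup>2)"
        using L2_diff[OF hL2 Cc_L2[OF g]] by (simp add: L2_def)
      show "integrable \<mu> (\<lambda>x. 3 * N * cmod (h n x - g0 x))"
        using hi[of n] Cc_integrable[OF g0(1)] by auto
      fix x
      show "(cmod (h n x - g x))\<^sup>2 \<le> 3 * N * cmod (h n x - g0 x)"
        unfolding power2_eq_square by (intro mult_mono le1 le2) (use N0 in auto)
    qed
    also have "\<dots> = 3 * N * (\<integral>x. cmod (h n x - g0 x) \<partial>\<mu>)" by simp
    also have "\<dots> \<le> 3 * N * d" using g0(2) N0 by (intro mult_left_mono) auto
    also have "\<dots> < (3 * N + 1) * d" using d by (simp add: algebra_simps)
    also have "\<dots> = (e/2)\<^sup>2" using N0 by (simp add: d_def add_nonneg_eq_0_iff)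
    finally have "L2_norm \<mu> (\<lambda>x. h n x - g x) < sqrt ((e/2)\<^sup>2)"
      unfolding L2_norm_def by (rule real_sqrt_less_mono)
    then show ?thesis using e by simp
  qed
  have "L2_norm \<mu> (\<lambda>x. \<xi> x - g x) \<le> L2_norm \<mu> (\<lambda>x. \<xi> x - h n x) + L2_norm \<mu> (\<lambda>x. h n x - g x)"
    using L2_norm_triangle[OF L2_diff[OF \<xi> hL2] L2_diff[OF hL2 Cc_L2[OF g]]] by simp
  then show ?thesis using a b g by (intro exI[of _ g]) simp
qed

subsection \<open>The trace argument\<close>

text \<open>Writes the norm through the trace, so that identities in the convolution algebra become
  identities of norms.\<close>

lemma L2_norm_sq_conv:
  assumes "Cc f" shows "complex_of_real ((L2_norm \<mu> f)\<^sup>2) = (star f \<star> f) 0"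
proof -
  have "(star f \<star> f) 0 = (\<integral>y. cnj (f (- y)) * f (- y) \<partial>\<mu>)"
    by (simp add: left_reg_def star_def)
  also have "\<dots> = (\<integral>y. cnj (f y) * f y \<partial>\<mu>)"
    by (intro measure_preserving_integral[OF inversion, where f="\<lambda>y. cnj (f y) * f y"]
        Cc_measurable Cc_mult_left continuous_intros Cc_continuous assms)
  also have "\<dots> = (\<integral>y. complex_of_real ((cmod (f y))\<^sup>2) \<partial>\<mu>)"
    by (simp only: complex_norm_square mult.commute)
  also have "\<dots> = complex_of_real ((L2_norm \<mu> f)\<^sup>2)"
    unfolding L2_norm_sq by (rule integral_complex_of_real)
  finally show ?thesis ..
qed

lemma L2_norm_star:
  assumes "Cc f" shows "L2_norm \<mu> (star f) = L2_norm \<mu> f"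
proof -
  have "complex_of_real ((L2_norm \<mu> (star f))\<^sup>2) = complex_of_real ((L2_norm \<mu> f)\<^sup>2)"
    using assms by (simp only: L2_norm_sq_conv Cc_star star_star conv_trace[of f "star f"])
  then have "(L2_norm \<mu> (star f))\<^sup>2 = (L2_norm \<mu> f)\<^sup>2" unfolding of_real_eq_iff .
  then show ?thesis by (simp add: L2_norm_nonneg power2_eq_iff_nonneg)
qed

lemma Young_Cc: "Cc f \<Longrightarrow> Cc \<xi> \<Longrightarrow> L2_norm \<mu> (f \<star> \<xi>) \<le> (\<integral>x. cmod (f x) \<partial>\<mu>) * L2_norm \<mu> \<xi>"
  by (intro Young_norm Cc_integrable Cc_L2 Cc_measurable Cc_conv)

text \<open>The isometry \<open>star\<close> exchanges left and right factors. This form lets a left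
  factor be small merely in \<open>L\<^sup>2\<close>.\<close>

lemma Young_Cc_right:
  assumes "Cc f" "Cc h" shows "L2_norm \<mu> (f \<star> h) \<le> L2_norm \<mu> f * (\<integral>x. cmod (star h x) \<partial>\<mu>)"
proof -
  have "L2_norm \<mu> (f \<star> h) = L2_norm \<mu> (star h \<star> star f)"
    using L2_norm_star[OF Cc_conv[OF assms]] star_conv[OF assms] by simp
  also have "\<dots> \<le> (\<integral>x. cmod (star h x) \<partial>\<mu>) * L2_norm \<mu> (star f)"
    using assms by (intro Young_Cc Cc_star)
  finally show ?thesis using L2_norm_star[OF assms(1)] by (simp add: mult.commute)
qed

text \<open>The pairs \<open>(p(u), p(v))\<close> for real polynomials \<open>p\<close> without constant term.\<close>

inductive poly_pair :: "('g \<Rightarrow> complex) \<Rightarrow> ('g \<Rightarrow> complex) \<Rightarrow> ('g \<Rightarrow> complex) \<Rightarrow> ('g \<Rightarrow> complex) \<Rightarrow> bool"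
  for u v where
  base: "poly_pair u v u v"
| step: "poly_pair u v x y \<Longrightarrow> poly_pair u v (u \<star> x) (v \<star> y)"
| add: "poly_pair u v x y \<Longrightarrow> poly_pair u v x' y' \<Longrightarrow> poly_pair u v (x + x') (y + y')"
| scal: "poly_pair u v x y \<Longrightarrow> poly_pair u v (scal (complex_of_real t) x) (scal (complex_of_real t) y)"

lemma poly_pair_Cc:
  assumes "Cc u" "Cc v" "poly_pair u v x y" shows "Cc x" "Cc y"
  using assms(3) by induction (auto intro: Cc_closed assms)

lemma poly_pair_commute:
  assumes uv: "Cc u" "Cc v" and "poly_pair u v x y" shows "u \<star> x = x \<star> u" "v \<star> y = y \<star> v"
  using assms(3)
proof induction
  case (step x y)
  note c = poly_pair_Cc[OF uv step(1)]
  case 1 show ?case using step.IH(1) conv_assoc[OF uv(1) c(1) uv(1)] by metis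
  case 2 show ?case using step.IH(2) conv_assoc[OF uv(2) c(2) uv(2)] by metis
next
  case (add x y x' y')
  note c = poly_pair_Cc[OF uv add(1)] poly_pair_Cc[OF uv add(2)]
  have "u \<star> (x + x') = (x + x') \<star> u" "v \<star> (y + y') = (y + y') \<star> v"
    using add c uv by (simp_all add: conv_simps)
  note this[unfolded plus_fun_def]
  case 1 show ?case by fact
  case 2 show ?case by fact
qed (simp_all add: conv_simps)

text \<open>Real coefficients and commutation with \<open>u\<close> and \<open>v\<close> give
  self-adjointness, so the squared norm of \<open>p(u)\<close> is the trace of its square.\<close>

lemma poly_pair_star:
  assumes uv: "Cc u" "Cc v" "star u = u" "star v = v" and "poly_pair u v x y"
  shows "star x = x" "star y = y"
  using assms(5)
proof induction
  case (step x y)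
  note c = poly_pair_Cc[OF uv(1,2) step(1)] and com = poly_pair_commute[OF uv(1,2) step(1)]
  case 1 show ?case using step c uv com by (simp add: star_conv)
  case 2 show ?case using step c uv com by (simp add: star_conv)
qed (simp_all add: uv star_add star_scal)

text \<open>Needed for squares: the trace comparison can then be applied to the square of a
  polynomial.\<close>

lemma poly_pair_mult:
  assumes uv: "Cc u" "Cc v" and "poly_pair u v x y" "poly_pair u v x' y'"
  shows "poly_pair u v (x \<star> x') (y \<star> y')"
  using assms(3)
proof induction
  case base show ?case by (rule poly_pair.step[OF assms(4)])
next
  case (step x y)
  note c = poly_pair_Cc[OF uv step(1)] poly_pair_Cc[OF uv assms(4)]
  show ?case using poly_pair.step[OF step(2)] c uv by (simp add: conv_assoc)
next
  case (add a b a' b')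
  note c = poly_pair_Cc[OF uv add(1)] poly_pair_Cc[OF uv add(2)] poly_pair_Cc[OF uv assms(4)]
  have "poly_pair u v ((a + a') \<star> x') ((b + b') \<star> y')"
    using poly_pair.add[OF add(3,4)] c by (simp add: conv_simps)
  then show ?case by (simp add: plus_fun_def)
next
  case (scal a b t)
  then show ?case using poly_pair.scal by (simp add: conv_simps)
qed

text \<open>With \<open>S = 1 - g\<close> one has \<open>S\<^sup>*S = 1 - u\<close>, \<open>SS\<^sup>* = 1 - v\<close> and \<open>S p(u) = p(v) S\<close>; traciality
  of \<open>f \<mapsto> f(0)\<close> then yields \<open>p(u)(0) = p(v)(0)\<close>.\<close>

lemma poly_pair_trace:
  fixes g :: "'g \<Rightarrow> complex"
  defines "u \<equiv> g + star g - star g \<star> g" and "v \<equiv> g + star g - g \<star> star g"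
  assumes g: "Cc g" and "poly_pair u v x y"
  shows "x - g \<star> x = y - y \<star> g" "x 0 = y 0"
proof -
  have uv: "Cc u" "Cc v" unfolding u_def v_def using g by (auto intro!: Cc_closed)
  \<comment> \<open>Both claims go through one induction, since the trace step uses the intertwining
    relation.\<close>
  have "x - g \<star> x = y - y \<star> g \<and> x 0 = y 0"
    using assms(4)
  proof induction
    case base
    have "u - g \<star> u = v - v \<star> g"
      unfolding u_def v_def using g by (simp add: conv_simps conv_assoc Cc_closed algebra_simps)
    moreover have "u 0 = v 0"
      unfolding u_def v_def using conv_trace[OF g Cc_star[OF g]] by simp
    ultimately show ?case ..
  next
    case (step x y)
    note c = poly_pair_Cc[OF uv step(1)]
    have IH: "x - g \<star> x = y - y \<star> g" "x 0 = y 0" using step(2) by (auto simp: fun_diff_def)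
    have base: "u - g \<star> u = v - v \<star> g"
      unfolding u_def v_def using g by (simp add: conv_simps conv_assoc Cc_closed algebra_simps)
    have "u \<star> x - g \<star> (u \<star> x) = (u - g \<star> u) \<star> x"
      using c g uv by (simp add: conv_simps conv_assoc Cc_closed)
    also have "\<dots> = v \<star> (x - g \<star> x)"
      unfolding base using c g uv by (simp add: conv_simps conv_assoc Cc_closed)
    also have "\<dots> = v \<star> y - (v \<star> y) \<star> g"
      unfolding IH(1) using c g uv by (simp add: conv_simps conv_assoc Cc_closed)
    finally have 1: "u \<star> x - g \<star> (u \<star> x) = v \<star> y - (v \<star> y) \<star> g" .
    \<comment> \<open>\<open>z\<close> is both \<open>S x\<close> and \<open>y S\<close>. Hence
      \<open>u \<star> x = x - S\<^sup>* z\<close> and \<open>y \<star> v = y - z S\<^sup>*\<close>,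
      and these have equal traces.\<close>
    define z where "z = y - y \<star> g"
    have z: "Cc z" "x - g \<star> x = z" unfolding z_def using c g IH by (auto intro!: Cc_closed)
    have "u \<star> x = x - (x - g \<star> x) + star g \<star> (x - g \<star> x)"
      unfolding u_def using c g by (simp add: conv_simps conv_assoc Cc_closed algebra_simps)
    then have "(u \<star> x) 0 = x 0 - z 0 + (star g \<star> z) 0"
      unfolding z(2) by simp
    also have "(star g \<star> z) 0 = (z \<star> star g) 0"
      by (rule conv_trace[OF Cc_star[OF g] z(1)])
    also have "x 0 - z 0 + (z \<star> star g) 0 = (y \<star> v) 0"
      unfolding z_def v_def using IH(2) c g by (simp add: conv_simps conv_assoc Cc_closed)
    also have "\<dots> = (v \<star> y) 0" by (rule conv_trace[OF c(2) uv(2)])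
    finally show ?case using 1 by (simp add: fun_diff_def)
  next
    case (add x y x' y')
    note c = poly_pair_Cc[OF uv add(1)] poly_pair_Cc[OF uv add(2)]
    have IH: "x - g \<star> x = y - y \<star> g" "x' - g \<star> x' = y' - y' \<star> g" "x 0 = y 0" "x' 0 = y' 0"
      using add(3,4) by (auto simp: fun_diff_def)
    have "x + x' - g \<star> (x + x') = (x - g \<star> x) + (x' - g \<star> x')"
      using c g by (simp add: conv_simps)
    also have "\<dots> = (y + y') - (y + y') \<star> g"
      unfolding IH(1,2) using c g by (simp add: conv_simps)
    finally show ?case using IH(3,4) by (simp add: fun_diff_def plus_fun_def)
  next
    case (scal x y t)
    have IH: "x - g \<star> x = y - y \<star> g" "x 0 = y 0" using scal(2) by (auto simp: fun_diff_def)
    have "scal t x - g \<star> scal t x = scal t y - scal t y \<star> g"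
      unfolding conv_scal_left conv_scal_right scal_diff[symmetric] IH ..
    then show ?case using IH(2) by (simp add: scal_def fun_diff_def)
  qed
  then show "x - g \<star> x = y - y \<star> g" "x 0 = y 0" by auto
qed

text \<open>A gradient step for the squared norm of \<open>S x\<close>: with
  \<open>y = S\<^sup>*S x\<close>, the squared norm of \<open>x - t y\<close> is that of
  \<open>x\<close>, minus \<open>2 * t\<close> times that of \<open>S x\<close>, plus
  \<open>t\<^sup>2\<close> times that of \<open>y\<close>. By Young's inequality \<open>C\<close>
  bounds \<open>S\<^sup>*\<close>, so with \<open>t = 1 / C\<^sup>2\<close> the last term costs at
  most half of the gain, and the lower bound on \<open>S x\<close> turns the rest into a
  contraction.\<close>

lemma Cc_gradient_step_contracts:
  fixes g x :: "'g \<Rightarrow> complex"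
  defines "u \<equiv> g + star g - star g \<star> g"
  assumes g: "Cc g" and x: "Cc x"
    and lower: "c * L2_norm \<mu> x \<le> L2_norm \<mu> (x - g \<star> x)" and c: "0 < c"
    and C: "C = 1 + (\<integral>y. cmod (star g y) \<partial>\<mu>)"
  shows "(L2_norm \<mu> (x - scal (complex_of_real (1 / C\<^sup>2)) (x - u \<star> x)))\<^sup>2 \<le> (1 - c\<^sup>2 / C\<^sup>2) * (L2_norm \<mu> x)\<^sup>2"
proof -
  define z where "z = x - g \<star> x"
  define y where "y = z - star g \<star> z"
  define t where "t = 1 / C\<^sup>2"
  have Cpos: "C \<ge> 1" unfolding C by simp
  have cc: "Cc z" "Cc y" "Cc u" unfolding y_def z_def u_def using x g by (auto intro!: Cc_closed)
  have y: "x - u \<star> x = y"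
    unfolding y_def z_def u_def using x g by (simp add: conv_simps conv_assoc Cc_closed algebra_simps)
  \<comment> \<open>The inner product of \<open>x\<close> with \<open>S\<^sup>*S x\<close> is the
    squared norm of \<open>S x\<close>, in algebraic form.\<close>
  have 1: "star x \<star> y = star z \<star> z"
    unfolding y_def z_def using x g by (simp add: conv_simps conv_assoc Cc_closed star_diff star_conv)
  have 2: "star y \<star> x = star z \<star> z"
    unfolding y_def z_def using x g by (simp add: conv_simps conv_assoc Cc_closed star_diff star_conv star_star)
  have "star (x - scal t y) \<star> (x - scal t y) = star x \<star> x - scal t (star x \<star> y) - (scal t (star y \<star> x) - scal t (scal t (star y \<star> y)))"
    using x cc by (simp add: conv_simps Cc_closed star_diff star_scal scal_diff)
  then have "(star (x - scal t y) \<star> (x - scal t y)) 0 = (star x \<star> x) 0 - t * (star z \<star> z) 0 - (t * (star z \<star> z) 0 - t * (t * (star y \<star> y) 0))"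
    unfolding 1 2 by (simp add: scal_def)
  then have "complex_of_real ((L2_norm \<mu> (x - scal t y))\<^sup>2) =
     complex_of_real ((L2_norm \<mu> x)\<^sup>2 - 2 * t * (L2_norm \<mu> z)\<^sup>2 + t\<^sup>2 * (L2_norm \<mu> y)\<^sup>2)"
    using L2_norm_sq_conv[OF x] L2_norm_sq_conv[OF cc(1)] L2_norm_sq_conv[OF cc(2)]
      L2_norm_sq_conv[of "x - scal t y"] x cc by (simp add: Cc_closed power2_eq_square)
  then have eq: "(L2_norm \<mu> (x - scal t y))\<^sup>2 = (L2_norm \<mu> x)\<^sup>2 - 2 * t * (L2_norm \<mu> z)\<^sup>2 + t\<^sup>2 * (L2_norm \<mu> y)\<^sup>2"
    unfolding of_real_eq_iff .
  have "L2_norm \<mu> y \<le> L2_norm \<mu> z + L2_norm \<mu> (star g \<star> z)"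
    unfolding y_def fun_diff_def using g cc by (intro L2_norm_triangle_diff Cc_L2 Cc_closed)
  also have "\<dots> \<le> C * L2_norm \<mu> z"
    using Young_Cc[of "star g" z] g cc unfolding C by (simp add: Cc_L2 Cc_star algebra_simps)
  finally have "(L2_norm \<mu> y)\<^sup>2 \<le> C\<^sup>2 * (L2_norm \<mu> z)\<^sup>2"
    by (metis L2_norm_nonneg power_mono power_mult_distrib)
  then have "t\<^sup>2 * (L2_norm \<mu> y)\<^sup>2 \<le> t\<^sup>2 * (C\<^sup>2 * (L2_norm \<mu> z)\<^sup>2)"
    by (intro mult_left_mono) auto
  also have "\<dots> = t * (L2_norm \<mu> z)\<^sup>2"
    using Cpos by (simp add: t_def power2_eq_square)
  finally have "(L2_norm \<mu> (x - scal t y))\<^sup>2 \<le> (L2_norm \<mu> x)\<^sup>2 - t * (L2_norm \<mu> z)\<^sup>2"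
    unfolding eq by (simp add: algebra_simps)
  also have "\<dots> \<le> (L2_norm \<mu> x)\<^sup>2 - t * (c * L2_norm \<mu> x)\<^sup>2"
    using lower c L2_norm_nonneg[of \<mu> x] unfolding z_def by (intro diff_left_mono mult_left_mono power_mono) (auto simp: t_def)
  also have "\<dots> = (1 - c\<^sup>2 / C\<^sup>2) * (L2_norm \<mu> x)\<^sup>2"
    by (simp add: t_def algebra_simps power_mult_distrib)
  finally show ?thesis unfolding y t_def .
qed

text \<open>The iterates \<open>U n\<close> and \<open>V n\<close> are \<open>p(u)\<close> and \<open>p(v)\<close> for \<open>p(s) = s (1 - t (1 - s))\<^sup>n\<close>.\<close>

lemma bounded_below_imp_dense_range:
  assumes g: "Cc g" and c: "0 < c" "c \<le> 1"
    and lower: "\<And>x. Cc x \<Longrightarrow> c * L2_norm \<mu> x \<le> L2_norm \<mu> (x - g \<star> x)"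
    and \<eta>: "Cc \<eta>" and e: "e > 0"
  shows "\<exists>\<xi>. Cc \<xi> \<and> L2_norm \<mu> (\<eta> - (\<xi> - g \<star> \<xi>)) < e"
proof -
  define u where "u = g + star g - star g \<star> g"
  define v where "v = g + star g - g \<star> star g"
  have uv: "Cc u" "Cc v" unfolding u_def v_def using g by (auto intro!: Cc_closed)
  have uvs: "star u = u" "star v = v"
    unfolding u_def v_def using g by (simp_all add: star_add star_diff star_star star_conv Cc_star add.commute)
  define C where "C = 1 + (\<integral>y. cmod (star g y) \<partial>\<mu>)"
  have Cpos: "C \<ge> 1" unfolding C_def by simp
  define t where "t = 1 / C\<^sup>2"
  \<comment> \<open>The contraction factor of one step; \<open>c \<le> 1 \<le> C\<close> makes it
    nonnegative.\<close>
  define r where "r = 1 - c\<^sup>2 / C\<^sup>2"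
  have "c\<^sup>2 \<le> C\<^sup>2" "0 < c\<^sup>2 / C\<^sup>2" using c Cpos by (auto intro!: power_mono divide_pos_pos)
  then have r: "0 \<le> r" "r < 1" using Cpos by (auto simp: r_def divide_le_eq)
  define U where "U = (\<lambda>n. ((\<lambda>x. x - scal (complex_of_real t) (x - u \<star> x)) ^^ n) u)"
  define V where "V = (\<lambda>n. ((\<lambda>x. x - scal (complex_of_real t) (x - v \<star> x)) ^^ n) v)"
  have U: "U 0 = u" "U (Suc n) = U n - scal (complex_of_real t) (U n - u \<star> U n)" for n by (auto simp: U_def)
  have V: "V 0 = v" "V (Suc n) = V n - scal (complex_of_real t) (V n - v \<star> V n)" for n by (auto simp: V_def)
  have re: "x - scal (complex_of_real t) (x - y) = scal (complex_of_real (1 - t)) x + scal (complex_of_real t) y" for x y :: "'g \<Rightarrow> complex"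
    by (simp add: scal_def fun_eq_iff algebra_simps)
  have pp: "poly_pair u v (U n) (V n)" for n
  proof (induction n)
    case 0 show ?case unfolding U V by (rule poly_pair.base)
  next
    case (Suc n) show ?case unfolding U V re
      using poly_pair.add[OF poly_pair.scal[OF Suc, of "1 - t"] poly_pair.scal[OF poly_pair.step[OF Suc], of t]]
      by (simp add: plus_fun_def)
  qed
  note UV = poly_pair_Cc[OF uv pp]
  have Ubound: "(L2_norm \<mu> (U n))\<^sup>2 \<le> r ^ n * (L2_norm \<mu> u)\<^sup>2" for n
  proof (induction n)
    case (Suc n)
    have "(L2_norm \<mu> (U (Suc n)))\<^sup>2 \<le> r * (L2_norm \<mu> (U n))\<^sup>2"
      unfolding U r_def t_def u_def
      by (rule Cc_gradient_step_contracts[OF g UV(1) lower[OF UV(1)] c(1) C_def])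
    also have "\<dots> \<le> r * (r ^ n * (L2_norm \<mu> u)\<^sup>2)"
      by (intro mult_left_mono Suc r)
    finally show ?case by (simp add: mult.assoc)
  qed (simp add: U)
  \<comment> \<open>Both iterates are self-adjoint, so their squared norms are the traces of their
    squares, which again form a pair.\<close>
  have eqn: "(L2_norm \<mu> (V n))\<^sup>2 = (L2_norm \<mu> (U n))\<^sup>2" for n
  proof -
    have "(U n \<star> U n) 0 = (V n \<star> V n) 0"
      using poly_pair_trace(2)[OF g poly_pair_mult[OF uv pp pp, unfolded u_def v_def]] unfolding u_def v_def .
    then have "complex_of_real ((L2_norm \<mu> (V n))\<^sup>2) = complex_of_real ((L2_norm \<mu> (U n))\<^sup>2)"
      using L2_norm_sq_conv[OF UV(1)] L2_norm_sq_conv[OF UV(2)] poly_pair_star[OF uv uvs pp] by simp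
    then show ?thesis unfolding of_real_eq_iff .
  qed
  have range: "\<exists>\<xi>. Cc \<xi> \<and> \<eta> - V n \<star> \<eta> = \<xi> - g \<star> \<xi>" for n
  proof (induction n)
    case 0
    have "\<eta> - V 0 \<star> \<eta> = (\<eta> - star g \<star> \<eta>) - g \<star> (\<eta> - star g \<star> \<eta>)"
      unfolding V v_def using g \<eta> by (simp add: conv_simps conv_assoc Cc_closed algebra_simps)
    moreover have "Cc (\<eta> - star g \<star> \<eta>)" using g \<eta> by (intro Cc_closed)
    ultimately show ?case by blast
  next
    case (Suc n)
    then obtain \<xi> where \<xi>: "Cc \<xi>" "\<eta> - V n \<star> \<eta> = \<xi> - g \<star> \<xi>" by blast
    \<comment> \<open>Passing to \<open>Suc n\<close> adds \<open>t SS\<^sup>* w\<close> to the left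
      side, which is the image under \<open>S\<close> of a multiple of
      \<open>\<zeta> = S\<^sup>* w\<close>.\<close>
    define w where "w = V n \<star> \<eta>"
    have w: "Cc w" unfolding w_def using UV \<eta> by (auto intro!: Cc_closed)
    define s where "s = complex_of_real t"
    define \<zeta> where "\<zeta> = w - star g \<star> w"
    have \<zeta>: "Cc \<zeta>" unfolding \<zeta>_def using w g by (auto intro!: Cc_closed)
    have "\<eta> - V (Suc n) \<star> \<eta> = (\<eta> - V n \<star> \<eta>) + scal s (w - v \<star> w)"
      unfolding V w_def s_def[symmetric] using UV[of n] uv \<eta> by (simp add: conv_simps conv_assoc Cc_closed)
    also have "w - v \<star> w = \<zeta> - g \<star> \<zeta>"
      unfolding v_def \<zeta>_def using g w by (simp add: conv_simps conv_assoc Cc_closed algebra_simps)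
    also have "(\<eta> - V n \<star> \<eta>) + scal s (\<zeta> - g \<star> \<zeta>) = (\<xi> + scal s \<zeta>) - g \<star> (\<xi> + scal s \<zeta>)"
      unfolding \<xi>(2) using \<xi>(1) \<zeta> g by (simp add: conv_simps Cc_closed scal_diff)
    finally have "\<eta> - V (Suc n) \<star> \<eta> = (\<xi> + scal s \<zeta>) - g \<star> (\<xi> + scal s \<zeta>)" .
    moreover have "Cc (\<xi> + scal s \<zeta>)" using \<xi>(1) \<zeta> by (intro Cc_closed)
    ultimately show ?case by blast
  qed
  define H where "H = (\<integral>x. cmod (star \<eta> x) \<partial>\<mu>)"
  have H0: "H \<ge> 0" by (simp add: H_def)
  have "(\<lambda>n. r ^ n * ((L2_norm \<mu> u)\<^sup>2 * H\<^sup>2)) \<longlonglongrightarrow> 0 * ((L2_norm \<mu> u)\<^sup>2 * H\<^sup>2)"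
    using r by (intro tendsto_intros LIMSEQ_power_zero) auto
  then have "\<forall>\<^sub>F n in sequentially. r ^ n * ((L2_norm \<mu> u)\<^sup>2 * H\<^sup>2) < e\<^sup>2"
    using e by (intro order_tendstoD(2)[where y=0]) auto
  then obtain n where n: "r ^ n * ((L2_norm \<mu> u)\<^sup>2 * H\<^sup>2) < e\<^sup>2"
    using eventually_happens'[OF sequentially_bot] by blast
  obtain \<xi> where \<xi>: "Cc \<xi>" "\<eta> - V n \<star> \<eta> = \<xi> - g \<star> \<xi>" using range by blast
  \<comment> \<open>\<open>V n\<close> is small in \<open>L\<^sup>2\<close> and not as an operator;
    this is enough because \<open>\<eta>\<close> is a fixed right factor in
    \<open>Cc\<close>.\<close>
  have "L2_norm \<mu> (V n \<star> \<eta>) \<le> L2_norm \<mu> (V n) * H"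
    unfolding H_def by (rule Young_Cc_right[OF UV(2) \<eta>])
  then have "(L2_norm \<mu> (V n \<star> \<eta>))\<^sup>2 \<le> (L2_norm \<mu> (U n))\<^sup>2 * H\<^sup>2"
    unfolding eqn[symmetric] power_mult_distrib[symmetric] using L2_norm_nonneg by (intro power_mono)
  also have "\<dots> \<le> r ^ n * (L2_norm \<mu> u)\<^sup>2 * H\<^sup>2"
    using Ubound by (intro mult_right_mono) auto
  also have "\<dots> < e\<^sup>2" using n by (simp add: mult.assoc)
  finally have "L2_norm \<mu> (V n \<star> \<eta>) < e" using e by (simp add: power2_less_imp_less)
  moreover have "\<eta> - (\<xi> - g \<star> \<xi>) = V n \<star> \<eta>" unfolding \<xi>(2)[symmetric] by simp
  ultimately show ?thesis using \<xi>(1) by auto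
qed

subsection \<open>The reduced group C*-algebra\<close>

text \<open>Holds almost everywhere only: where an integral fails to exist, the default value 0 may
  break additivity.\<close>

lemma left_reg_linear:
  assumes f: "integrable \<mu> f" and "L2 \<mu> \<xi>" "L2 \<mu> \<eta>"
  shows "AE x in \<mu>. (f \<star> (\<lambda>y. \<xi> y + c * \<eta> y)) x = (f \<star> \<xi>) x + c * (f \<star> \<eta>) x"
  using Young_integrable[OF f assms(2)] Young_integrable[OF f assms(3)]
proof eventually_elim
  case (elim x)
  have "(\<integral>y. f y * (\<xi> (- y + x) + c * \<eta> (- y + x)) \<partial>\<mu>) = (\<integral>y. f y * \<xi> (- y + x) + c * (f y * \<eta> (- y + x)) \<partial>\<mu>)"
    by (simp add: algebra_simps)
  also have "\<dots> = (\<integral>y. f y * \<xi> (- y + x) \<partial>\<mu>) + c * (\<integral>y. f y * \<eta> (- y + x) \<partial>\<mu>)"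
    using elim by (subst Bochner_Integration.integral_add) auto
  finally show ?case by (simp add: left_reg_def)
qed

lemma Cstar_L2: "T \<in> reduced_group_Cstar \<mu> \<Longrightarrow> L2 \<mu> \<xi> \<Longrightarrow> L2 \<mu> (T \<xi>)"
  by (simp add: reduced_group_Cstar_def)

lemma Cstar_approx:
  assumes "T \<in> reduced_group_Cstar \<mu>" "e > 0"
  obtains f where "integrable \<mu> f" "\<And>\<xi>. L2 \<mu> \<xi> \<Longrightarrow> L2 \<mu> (f \<star> \<xi>)"
    "\<And>\<xi>. L2 \<mu> \<xi> \<Longrightarrow> L2_norm \<mu> (\<lambda>x. T \<xi> x - (f \<star> \<xi>) x) \<le> e * L2_norm \<mu> \<xi>"
  using assms unfolding reduced_group_Cstar_def by blast

lemma Cstar_bounded: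
  assumes T: "T \<in> reduced_group_Cstar \<mu>"
  obtains M where "M \<ge> 0" "\<And>\<xi>. L2 \<mu> \<xi> \<Longrightarrow> L2_norm \<mu> (T \<xi>) \<le> M * L2_norm \<mu> \<xi>"
proof -
  obtain f where f: "integrable \<mu> f" "\<And>\<xi>. L2 \<mu> \<xi> \<Longrightarrow> L2 \<mu> (f \<star> \<xi>)"
    "\<And>\<xi>. L2 \<mu> \<xi> \<Longrightarrow> L2_norm \<mu> (\<lambda>x. T \<xi> x - (f \<star> \<xi>) x) \<le> 1 * L2_norm \<mu> \<xi>"
    using Cstar_approx[OF T, of 1] by auto
  show ?thesis
  proof (rule that[of "1 + (\<integral>x. cmod (f x) \<partial>\<mu>)"])
    fix \<xi> assume \<xi>: "L2 \<mu> \<xi>"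
    have "L2_norm \<mu> (T \<xi>) \<le> L2_norm \<mu> (\<lambda>x. T \<xi> x - (f \<star> \<xi>) x) + L2_norm \<mu> (f \<star> \<xi>)"
      using L2_norm_triangle[OF L2_diff[OF Cstar_L2[OF T \<xi>] f(2)[OF \<xi>]] f(2)[OF \<xi>]] by simp
    also have "\<dots> \<le> (1 + (\<integral>x. cmod (f x) \<partial>\<mu>)) * L2_norm \<mu> \<xi>"
      using f(3)[OF \<xi>] Young_norm[OF f(1) \<xi> L2_measurable[OF f(2)[OF \<xi>]]] by (simp add: algebra_simps)
    finally show "L2_norm \<mu> (T \<xi>) \<le> (1 + (\<integral>x. cmod (f x) \<partial>\<mu>)) * L2_norm \<mu> \<xi>" .
  qed simp
qed

text \<open>Elements of \<open>reduced_group_Cstar\<close> are bare maps on representatives.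
  Linearity is inherited from the approximants: the defect \<open>D\<close> has norm at most
  \<open>e * B\<close> for every positive \<open>e\<close>.\<close>

lemma Cstar_linear:
  assumes T: "T \<in> reduced_group_Cstar \<mu>" and \<xi>: "L2 \<mu> \<xi>" and \<eta>: "L2 \<mu> \<eta>"
  shows "AE x in \<mu>. T (\<lambda>y. \<xi> y + c * \<eta> y) x = T \<xi> x + c * T \<eta> x"
proof -
  define \<zeta> where "\<zeta> = (\<lambda>y. \<xi> y + c * \<eta> y)"
  have \<zeta>: "L2 \<mu> \<zeta>" unfolding \<zeta>_def by (intro L2_add \<xi> L2_scale \<eta>)
  note TL = Cstar_L2[OF T]
  define D where "D = (\<lambda>x. T \<zeta> x - (T \<xi> x + c * T \<eta> x))"
  have D: "L2 \<mu> D" unfolding D_def by (intro L2_diff L2_add L2_scale TL \<xi> \<eta> \<zeta>)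
  define B where "B = L2_norm \<mu> \<zeta> + (L2_norm \<mu> \<xi> + cmod c * L2_norm \<mu> \<eta>)"
  have B0: "B \<ge> 0" unfolding B_def by (intro add_nonneg_nonneg mult_nonneg_nonneg L2_norm_nonneg) auto
  have bound: "L2_norm \<mu> D \<le> e * B" if e: "e > 0" for e
  proof -
    obtain f where f: "integrable \<mu> f" "\<And>\<xi>. L2 \<mu> \<xi> \<Longrightarrow> L2 \<mu> (f \<star> \<xi>)"
      "\<And>\<xi>. L2 \<mu> \<xi> \<Longrightarrow> L2_norm \<mu> (\<lambda>x. T \<xi> x - (f \<star> \<xi>) x) \<le> e * L2_norm \<mu> \<xi>"
      using Cstar_approx[OF T e] by blast
    define R where "R = (\<lambda>\<xi> x. T \<xi> x - (f \<star> \<xi>) x)"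
    have R: "L2 \<mu> (R \<xi>)" "L2_norm \<mu> (R \<xi>) \<le> e * L2_norm \<mu> \<xi>" if "L2 \<mu> \<xi>" for \<xi>
      using f that unfolding R_def by (auto intro!: L2_diff TL)
    have "L2_norm \<mu> D = L2_norm \<mu> (\<lambda>x. R \<zeta> x - (R \<xi> x + c * R \<eta> x))"
    proof (rule L2_norm_cong_AE)
      show "D \<in> borel_measurable \<mu>" using D by (rule L2_measurable)
      show "(\<lambda>x. R \<zeta> x - (R \<xi> x + c * R \<eta> x)) \<in> borel_measurable \<mu>"
        by (intro L2_measurable L2_diff L2_add L2_scale R \<xi> \<eta> \<zeta>)
      show "AE x in \<mu>. D x = R \<zeta> x - (R \<xi> x + c * R \<eta> x)"
        using left_reg_linear[OF f(1) \<xi> \<eta>, of c] unfolding \<zeta>_def[symmetric]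
        by eventually_elim (simp add: D_def R_def algebra_simps)
    qed
    also have "\<dots> \<le> L2_norm \<mu> (R \<zeta>) + L2_norm \<mu> (\<lambda>x. R \<xi> x + c * R \<eta> x)"
      by (intro L2_norm_triangle_diff L2_add L2_scale R \<xi> \<eta> \<zeta>)
    also have "L2_norm \<mu> (\<lambda>x. R \<xi> x + c * R \<eta> x) \<le> L2_norm \<mu> (R \<xi>) + cmod c * L2_norm \<mu> (R \<eta>)"
      using L2_norm_triangle[OF R(1)[OF \<xi>] L2_scale[OF R(1)[OF \<eta>]], of c] by (simp add: L2_norm_scale)
    also have "L2_norm \<mu> (R \<zeta>) + (L2_norm \<mu> (R \<xi>) + cmod c * L2_norm \<mu> (R \<eta>)) \<le>
        e * L2_norm \<mu> \<zeta> + (e * L2_norm \<mu> \<xi> + cmod c * (e * L2_norm \<mu> \<eta>))"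
      by (intro add_mono mult_left_mono R \<xi> \<eta> \<zeta>) auto
    finally show ?thesis by (simp add: B_def algebra_simps)
  qed
  have "L2_norm \<mu> D \<le> 0"
  proof (rule field_le_epsilon)
    fix e :: real assume "0 < e"
    then have "0 < e / (B + 1)" using B0 by (intro divide_pos_pos) auto
    from bound[OF this] have "L2_norm \<mu> D \<le> e / (B + 1) * B" .
    also have "\<dots> \<le> e" using B0 \<open>0 < e\<close> by (simp add: field_simps)
    finally show "L2_norm \<mu> D \<le> 0 + e" by simp
  qed
  then have "AE x in \<mu>. D x = 0"
    using L2_norm_nonneg[of \<mu> D] by (intro L2_norm_zero_AE D) simp
  then show ?thesis unfolding \<zeta>_def[symmetric] by eventually_elim (simp add: D_def)
qed

lemma Cstar_add:
  assumes "T \<in> reduced_group_Cstar \<mu>" "L2 \<mu> \<xi>" "L2 \<mu> \<eta>"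
  shows "AE x in \<mu>. T (\<lambda>y. \<xi> y + \<eta> y) x = T \<xi> x + T \<eta> x"
  using Cstar_linear[OF assms, of 1] by simp

lemma Cstar_diff:
  assumes "T \<in> reduced_group_Cstar \<mu>" "L2 \<mu> \<xi>" "L2 \<mu> \<eta>"
  shows "AE x in \<mu>. T (\<lambda>y. \<xi> y - \<eta> y) x = T \<xi> x - T \<eta> x"
  using Cstar_linear[OF assms, of "-1"] by simp

text \<open>For \<open>\<xi>\<close> in \<open>Cc\<close> all convolution integrals exist at every
  point, so convolution by the difference \<open>f - g\<close> is exactly the difference of two
  measurable functions and Young's inequality applies.\<close>

lemma Cstar_approx_Cc:
  assumes T: "T \<in> reduced_group_Cstar \<mu>" and e: "e > 0"
  obtains g where "Cc g" "\<And>\<xi>. Cc \<xi> \<Longrightarrow> L2_norm \<mu> (\<lambda>x. T \<xi> x - (g \<star> \<xi>) x) \<le> e * L2_norm \<mu> \<xi>"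
proof -
  have e2: "e / 2 > 0" using e by simp
  obtain f where f: "integrable \<mu> f" "\<And>\<xi>. L2 \<mu> \<xi> \<Longrightarrow> L2 \<mu> (f \<star> \<xi>)"
    "\<And>\<xi>. L2 \<mu> \<xi> \<Longrightarrow> L2_norm \<mu> (\<lambda>x. T \<xi> x - (f \<star> \<xi>) x) \<le> e / 2 * L2_norm \<mu> \<xi>"
    using Cstar_approx[OF T e2] by blast
  obtain g where g: "Cc g" "(\<integral>x. cmod (f x - g x) \<partial>\<mu>) < e / 2" using L1_dense[OF f(1) e2] by blast
  show ?thesis
  proof (rule that[OF g(1)])
    fix \<xi> :: "'g \<Rightarrow> complex" assume \<xi>c: "Cc \<xi>"
    have \<xi>: "L2 \<mu> \<xi>" by (rule Cc_L2[OF \<xi>c])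
    have int: "integrable \<mu> (\<lambda>y. k y * \<xi> (- y + x))" if k: "integrable \<mu> k" for k x
    proof -
      obtain B where B: "\<And>x. norm (\<xi> x) \<le> B" "B \<ge> 0" using Cc_bounded[OF \<xi>c] by blast
      show ?thesis
      proof (rule Bochner_Integration.integrable_bound)
        show "integrable \<mu> (\<lambda>y. k y * of_real B)" using k by simp
        show "(\<lambda>y. k y * \<xi> (- y + x)) \<in> borel_measurable \<mu>"
          using k reflection_measurable[OF Cc_measurable[OF \<xi>c], of x] by auto
        show "AE y in \<mu>. norm (k y * \<xi> (- y + x)) \<le> norm (k y * of_real B)"
          using B by (intro AE_I2) (auto simp: norm_mult intro!: mult_left_mono)
      qed
    qed
    have d: "(\<lambda>x. f x - g x) \<star> \<xi> = (\<lambda>x. (f \<star> \<xi>) x - (g \<star> \<xi>) x)"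
      using int[OF f(1)] int[OF Cc_integrable[OF g(1)]] by (simp add: left_reg_def fun_eq_iff left_diff_distrib)
    have gL: "L2 \<mu> (g \<star> \<xi>)" by (intro Cc_L2 Cc_conv g \<xi>c)
    have "L2_norm \<mu> (\<lambda>x. (f \<star> \<xi>) x - (g \<star> \<xi>) x) \<le> (\<integral>x. cmod (f x - g x) \<partial>\<mu>) * L2_norm \<mu> \<xi>"
      unfolding d[symmetric] using f(1) Cc_integrable[OF g(1)] \<xi>
      by (intro Young_norm) (auto simp: d intro!: L2_measurable L2_diff f(2) gL)
    also have "\<dots> \<le> e / 2 * L2_norm \<mu> \<xi>"
      using g(2) L2_norm_nonneg by (intro mult_right_mono) auto
    finally have "L2_norm \<mu> (\<lambda>x. (f \<star> \<xi>) x - (g \<star> \<xi>) x) \<le> e / 2 * L2_norm \<mu> \<xi>" .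
    moreover have "L2_norm \<mu> (\<lambda>x. T \<xi> x - (g \<star> \<xi>) x) \<le>
      L2_norm \<mu> (\<lambda>x. T \<xi> x - (f \<star> \<xi>) x) + L2_norm \<mu> (\<lambda>x. (f \<star> \<xi>) x - (g \<star> \<xi>) x)"
      using L2_norm_triangle[OF L2_diff[OF Cstar_L2[OF T \<xi>] f(2)[OF \<xi>]] L2_diff[OF f(2)[OF \<xi>] gL]] by simp
    ultimately show "L2_norm \<mu> (\<lambda>x. T \<xi> x - (g \<star> \<xi>) x) \<le> e * L2_norm \<mu> \<xi>"
      using f(3)[OF \<xi>] by (simp add: field_simps)
  qed
qed

text \<open>If \<open>T = 1 - a\<close> kills \<open>\<eta>\<close> and \<open>S \<xi>\<close> is
  close to \<open>\<eta>\<close>, then \<open>T (S \<xi>)\<close> is small. As \<open>T S\<close> is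
  bounded below, \<open>\<xi>\<close> is small, hence so are \<open>S \<xi>\<close> and
  \<open>\<eta>\<close>.\<close>

lemma left_quasi_inverse_injective:
  assumes a: "a \<in> reduced_group_Cstar \<mu>" and b: "b \<in> reduced_group_Cstar \<mu>"
    and ab: "op_eq \<mu> (op_diamond a b) (\<lambda>\<xi> x. 0)"
    and \<eta>: "L2 \<mu> \<eta>" and fix_\<eta>: "AE x in \<mu>. a \<eta> x = \<eta> x"
  shows "AE x in \<mu>. \<eta> x = 0"
proof -
  obtain M where M: "M \<ge> 0" "\<And>\<xi>. L2 \<mu> \<xi> \<Longrightarrow> L2_norm \<mu> (a \<xi>) \<le> M * L2_norm \<mu> \<xi>"
    using Cstar_bounded[OF a] by blast
  \<comment> \<open>\<open>1 + M\<close> bounds \<open>T\<close>, so an error of size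
    \<open>e\<close> in \<open>b\<close> costs half of the norm of \<open>\<xi>\<close>. The same
    \<open>e\<close> serves below as the lower bound for \<open>S\<close>.\<close>
  define e where "e = 1 / (2 * (1 + M))"
  have e: "e > 0" "(1 + M) * e = 1 / 2" "e \<le> 1" using M(1) by (auto simp: e_def field_simps)
  obtain g where g: "Cc g" "\<And>\<xi>. Cc \<xi> \<Longrightarrow> L2_norm \<mu> (\<lambda>x. b \<xi> x - (g \<star> \<xi>) x) \<le> e * L2_norm \<mu> \<xi>"
    using Cstar_approx_Cc[OF b e(1)] by blast
  define T where "T = (\<lambda>\<xi> x. \<xi> x - a \<xi> x)"
  have TL: "L2 \<mu> (T \<xi>)" if "L2 \<mu> \<xi>" for \<xi>
    unfolding T_def using that by (intro L2_diff Cstar_L2[OF a])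
  have Tb: "L2_norm \<mu> (T \<xi>) \<le> (1 + M) * L2_norm \<mu> \<xi>" if "L2 \<mu> \<xi>" for \<xi>
    using L2_norm_triangle_diff[OF that Cstar_L2[OF a that]] M(2)[OF that] by (simp add: T_def algebra_simps)
  define S where "S = (\<lambda>\<xi>. \<xi> - g \<star> \<xi>)"
  have Sc: "Cc (S \<xi>)" if "Cc \<xi>" for \<xi> unfolding S_def using that g(1) by (intro Cc_closed)
  have near: "L2_norm \<mu> \<xi> \<le> 2 * L2_norm \<mu> (T (S \<xi>))" if \<xi>c: "Cc \<xi>" for \<xi>
  proof -
    note \<xi> = Cc_L2[OF \<xi>c] and SL = Cc_L2[OF Sc[OF \<xi>c]]
    define r where "r = (\<lambda>x. b \<xi> x - (g \<star> \<xi>) x)"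
    have r: "L2 \<mu> r" unfolding r_def by (intro L2_diff Cstar_L2[OF b] Cc_L2 Cc_conv g(1) \<xi>c)
    have bL: "L2 \<mu> (b \<xi>)" by (rule Cstar_L2[OF b \<xi>])
    have S_eq: "S \<xi> = (\<lambda>x. (\<xi> x - b \<xi> x) + r x)" by (simp add: S_def r_def fun_eq_iff)
    have h: "AE x in \<mu>. a \<xi> x + b \<xi> x - a (b \<xi>) x = 0"
      using ab \<xi> by (simp add: op_eq_def op_diamond_def)
    \<comment> \<open>The hypothesis says \<open>(1 - a)(1 - b) = 1\<close>, so \<open>T\<close>
      maps \<open>\<xi> - b \<xi>\<close> back to \<open>\<xi>\<close>.\<close>
    have "AE x in \<mu>. \<xi> x = T (S \<xi>) x - T r x"
      using h Cstar_add[OF a L2_diff[OF \<xi> bL] r] Cstar_diff[OF a \<xi> bL] unfolding S_eq[symmetric]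
    proof eventually_elim
      case (elim x)
      have "S \<xi> x = \<xi> x - b \<xi> x + r x" by (simp add: S_eq)
      then show ?case using elim unfolding T_def by algebra
    qed
    then have "L2_norm \<mu> \<xi> = L2_norm \<mu> (\<lambda>x. T (S \<xi>) x - T r x)"
      by (intro L2_norm_cong_AE L2_measurable L2_diff TL SL r \<xi>)
    also have "\<dots> \<le> L2_norm \<mu> (T (S \<xi>)) + L2_norm \<mu> (T r)"
      by (intro L2_norm_triangle_diff TL SL r)
    also have "L2_norm \<mu> (T r) \<le> (1 + M) * (e * L2_norm \<mu> \<xi>)"
      using M(1) by (intro order_trans[OF Tb[OF r]] mult_left_mono) (use g(2)[OF \<xi>c] in \<open>auto simp: r_def\<close>)
    also have "\<dots> = L2_norm \<mu> \<xi> / 2"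
      using e(2) by (simp add: mult.assoc[symmetric])
    finally show ?thesis by simp
  qed
  have lower: "e * L2_norm \<mu> \<xi> \<le> L2_norm \<mu> (\<xi> - g \<star> \<xi>)" if "Cc \<xi>" for \<xi>
  proof -
    have "L2_norm \<mu> \<xi> \<le> 2 * ((1 + M) * L2_norm \<mu> (S \<xi>))"
      using near[OF that] Tb[OF Cc_L2[OF Sc[OF that]]] by linarith
    then show ?thesis using M(1) by (simp add: e_def S_def field_simps)
  qed
  define C where "C = 1 + (\<integral>x. cmod (g x) \<partial>\<mu>)"
  have Sb: "L2_norm \<mu> (S \<xi>) \<le> C * L2_norm \<mu> \<xi>" if "Cc \<xi>" for \<xi>
  proof -
    have "L2_norm \<mu> (S \<xi>) \<le> L2_norm \<mu> \<xi> + L2_norm \<mu> (g \<star> \<xi>)"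
      unfolding S_def fun_diff_def using that g(1) by (intro L2_norm_triangle_diff Cc_L2 Cc_conv)
    then show ?thesis using Young_Cc[OF g(1) that] by (simp add: C_def algebra_simps)
  qed
  \<comment> \<open>The error \<open>w\<close> contributes 2, one for each approximation; the rest
    bounds \<open>S \<xi>\<close> through the norm of \<open>\<xi>\<close>.\<close>
  define B where "B = 2 + C * (4 * (1 + M))"
  have C0: "C \<ge> 0" by (simp add: C_def)
  have B0: "B > 0" unfolding B_def using C0 M(1) by (intro add_pos_nonneg) auto
  have small: "L2_norm \<mu> \<eta> \<le> B * d" if d: "d > 0" for d
  proof -
    obtain \<eta>' where \<eta>': "Cc \<eta>'" "L2_norm \<mu> (\<lambda>x. \<eta> x - \<eta>' x) < d" using L2_dense[OF \<eta> d] by blast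
    obtain \<xi> where \<xi>: "Cc \<xi>" "L2_norm \<mu> (\<eta>' - S \<xi>) < d"
      using bounded_below_imp_dense_range[OF g(1) e(1,3) lower \<eta>'(1) d] unfolding S_def by blast
    note SL = Cc_L2[OF Sc[OF \<xi>(1)]]
    define w where "w = (\<lambda>x. \<eta> x - S \<xi> x)"
    have w: "L2 \<mu> w" unfolding w_def by (intro L2_diff \<eta> SL)
    have wd: "L2_norm \<mu> w \<le> 2 * d"
      using L2_norm_triangle[OF L2_diff[OF \<eta> Cc_L2[OF \<eta>'(1)]] L2_diff[OF Cc_L2[OF \<eta>'(1)] SL]] \<eta>'(2) \<xi>(2)
      by (simp add: w_def fun_diff_def)
    have "AE x in \<mu>. T (S \<xi>) x = - T w x"
      using fix_\<eta> Cstar_diff[OF a \<eta> SL] unfolding w_def[symmetric]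
      by eventually_elim (simp add: T_def, simp add: w_def)
    then have "L2_norm \<mu> (T (S \<xi>)) = L2_norm \<mu> (\<lambda>x. - T w x)"
      by (intro L2_norm_cong_AE L2_measurable L2_uminus TL SL w)
    also have "\<dots> \<le> (1 + M) * (2 * d)"
      unfolding L2_norm_uminus using M(1) by (intro order_trans[OF Tb[OF w]] mult_left_mono wd) auto
    finally have "L2_norm \<mu> \<xi> \<le> 4 * (1 + M) * d" using near[OF \<xi>(1)] by (simp add: algebra_simps)
    then have "C * L2_norm \<mu> \<xi> \<le> C * (4 * (1 + M) * d)" by (rule mult_left_mono[OF _ C0])
    then have "L2_norm \<mu> (S \<xi>) \<le> C * (4 * (1 + M) * d)" using Sb[OF \<xi>(1)] by linarith
    moreover have "L2_norm \<mu> \<eta> \<le> L2_norm \<mu> w + L2_norm \<mu> (S \<xi>)"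
      using L2_norm_triangle[OF w SL] by (simp add: w_def)
    ultimately show ?thesis using wd by (simp add: B_def algebra_simps)
  qed
  have "L2_norm \<mu> \<eta> \<le> 0"
  proof (rule field_le_epsilon)
    fix d :: real assume "0 < d"
    then show "L2_norm \<mu> \<eta> \<le> 0 + d" using small[of "d / B"] B0 by simp
  qed
  then show ?thesis
    using L2_norm_nonneg[of \<mu> \<eta>] by (intro L2_norm_zero_AE \<eta>) simp
qed

text \<open>\<open>op_diamond b a\<close> is \<open>1 - (1 - b)(1 - a)\<close>. Since
  \<open>(1 - a)(1 - b) = 1\<close>, applying \<open>1 - a\<close> to it gives 0, and injectivity
  finishes.\<close>

lemma left_quasi_inverse_is_right:
  assumes a: "a \<in> reduced_group_Cstar \<mu>" and b: "b \<in> reduced_group_Cstar \<mu>"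
    and ab: "op_eq \<mu> (op_diamond a b) (\<lambda>\<xi> x. 0)"
  shows "op_eq \<mu> (op_diamond b a) (\<lambda>\<xi> x. 0)"
  unfolding op_eq_def
proof (intro allI impI)
  fix \<zeta> assume \<zeta>: "L2 \<mu> \<zeta>"
  note L = Cstar_L2[OF a] Cstar_L2[OF b] L2_add L2_diff
  have h: "AE x in \<mu>. a \<xi> x + b \<xi> x - a (b \<xi>) x = 0" if "L2 \<mu> \<xi>" for \<xi>
    using ab that by (simp add: op_eq_def op_diamond_def)
  define \<eta> where "\<eta> = (\<lambda>x. b \<zeta> x + a \<zeta> x - b (a \<zeta>) x)"
  have "AE x in \<mu>. a \<eta> x = \<eta> x"
    using h[OF \<zeta>] h[OF L(1)[OF \<zeta>]] Cstar_add[OF a L(2)[OF \<zeta>] L(1)[OF \<zeta>]]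
      Cstar_diff[OF a L2_add[OF L(2)[OF \<zeta>] L(1)[OF \<zeta>]] L(2)[OF L(1)[OF \<zeta>]]]
    unfolding \<eta>_def[symmetric]
  proof eventually_elim
    case (elim x)
    have "\<eta> x = b \<zeta> x + a \<zeta> x - b (a \<zeta>) x" by (simp add: \<eta>_def)
    with elim show ?case by algebra
  qed
  then have "AE x in \<mu>. \<eta> x = 0"
    by (intro left_quasi_inverse_injective[OF a b ab]) (auto simp: \<eta>_def intro!: L \<zeta>)
  then show "AE x in \<mu>. op_diamond b a \<zeta> x = 0"
    by (simp add: op_diamond_def \<eta>_def)
qed

end

theorem theorem3p2:
  fixes \<mu> :: "'g::{topological_group_add,t2_space} measure"
  assumes "locally_compact_group TYPE('g)"
    and "left_haar_measure \<mu>"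
    and "right_invariant \<mu>"
  shows "quasi_directly_finite (reduced_group_Cstar \<mu>) op_diamond (op_eq \<mu>) (\<lambda>\<xi> x. 0)"
proof -
  interpret unimodular_haar \<mu> using assms by unfold_locales
  show ?thesis
    unfolding quasi_directly_finite_def using left_quasi_inverse_is_right by blast
qed

end
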